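(* Let $A=D(A)\oplus R(A)$ be an Abelian group, where $D(A)\neq 0$ is the divisible part and $R(A)\neq 0$ is the reduced part of $A$. Then $\mathrm{End}\,A$ is centrally essential if and only if $R(A)\cong\bigoplus_{p\in P'}Z_{p^{k_p}}$ (with positive integers $k_p$) and either $D(A)\cong Q$ or $D(A)\cong\bigoplus_{p\in P''}Z_{p^\infty}$, where $P'$ and $P''$ are sets of pairwise distinct primes with $P'\cap P''=\emptyset$.
   Context: All rings are associative with non-zero identity. A ring $R$ is centrally essential if for every non-zero $a\in R$ there exist non-zero elements $x,y$ of the center of $R$ with $ax=y$. $Q$ is the additive group of rationals, $Z_{p^k}$ the cyclic group of order $p^k$, $Z_{p^\infty}$ the quasi-cyclic $p$-group. Every Abelian group decomposes as the direct sum of its maximal divisible subgroup $D(A)$ and a reduced subgroup $R(A)$. *)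

theory Defs
  imports Complex_Main "HOL-Computational_Algebra.Primes"
begin

primrec nsmul :: "nat \<Rightarrow> 'a::ab_group_add \<Rightarrow> 'a" where
  "nsmul 0 x = 0"
| "nsmul (Suc n) x = x + nsmul n x"

definition subgrp :: "'a::ab_group_add set \<Rightarrow> bool" where
  "subgrp S \<longleftrightarrow> 0 \<in> S \<and> (\<forall>x\<in>S. \<forall>y\<in>S. x + y \<in> S) \<and> (\<forall>x\<in>S. - x \<in> S)"

definition divisible_subgrp :: "'a::ab_group_add set \<Rightarrow> bool" where
  "divisible_subgrp S \<longleftrightarrow> subgrp S \<and> (\<forall>x\<in>S. \<forall>n>0. \<exists>y\<in>S. nsmul n y = x)"

text \<open>D(A): the maximal divisible subgroup (union of all divisible subgroups).\<close>
definition div_part :: "'a::ab_group_add set" where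
  "div_part = \<Union>{S. divisible_subgrp S}"

definition is_direct_complement :: "'a::ab_group_add set \<Rightarrow> 'a set \<Rightarrow> bool" where
  "is_direct_complement D R \<longleftrightarrow> subgrp R \<and> D \<inter> R = {0} \<and>
     (\<forall>a. \<exists>d\<in>D. \<exists>r\<in>R. a = d + r)"

definition iso_onto :: "'a::ab_group_add set \<Rightarrow> 'b set \<Rightarrow> ('b \<Rightarrow> 'b \<Rightarrow> 'b) \<Rightarrow> bool" where
  "iso_onto S T op \<longleftrightarrow> (\<exists>f. bij_betw f S T \<and> (\<forall>x\<in>S. \<forall>y\<in>S. f (x + y) = op (f x) (f y)))"

text \<open>The direct sum of cyclic groups Z_{p^{k p}}, p \<in> P: finitely supported functions with
 p-th coordinate in {0..<p^k p}, addition coordinatewise modulo p^(k p).\<close>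
definition cyc_sum :: "nat set \<Rightarrow> (nat \<Rightarrow> nat) \<Rightarrow> (nat \<Rightarrow> int) set" where
  "cyc_sum P k = {f. finite {p. f p \<noteq> 0} \<and> (\<forall>p. f p \<noteq> 0 \<longrightarrow> p \<in> P) \<and>
       (\<forall>p\<in>P. 0 \<le> f p \<and> f p < int p ^ k p)}"

definition cyc_sum_add :: "(nat \<Rightarrow> nat) \<Rightarrow> (nat \<Rightarrow> int) \<Rightarrow> (nat \<Rightarrow> int) \<Rightarrow> nat \<Rightarrow> int" where
  "cyc_sum_add k f g = (\<lambda>p. (f p + g p) mod (int p ^ k p))"

text \<open>The direct sum of quasi-cyclic groups Z_{p^\<infinity>}, p \<in> P: Z_{p^\<infinity>} is realised as the
 rationals in [0,1) with p-power denominator, addition modulo 1.\<close>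
definition prufer_sum :: "nat set \<Rightarrow> (nat \<Rightarrow> rat) set" where
  "prufer_sum P = {f. finite {p. f p \<noteq> 0} \<and> (\<forall>p. f p \<noteq> 0 \<longrightarrow> p \<in> P) \<and>
       (\<forall>p\<in>P. 0 \<le> f p \<and> f p < 1 \<and> (\<exists>n. f p * of_nat (p ^ n) \<in> \<int>))}"

definition prufer_sum_add :: "(nat \<Rightarrow> rat) \<Rightarrow> (nat \<Rightarrow> rat) \<Rightarrow> nat \<Rightarrow> rat" where
  "prufer_sum_add f g = (\<lambda>p. frac (f p + g p))"

definition End_ring :: "('a::ab_group_add \<Rightarrow> 'a) set" where
  "End_ring = {f. \<forall>x y. f (x + y) = f x + f y}"

definition End_center :: "('a::ab_group_add \<Rightarrow> 'a) set" where
  "End_center = {c\<in>End_ring. \<forall>g\<in>End_ring. c \<circ> g = g \<circ> c}"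

definition End_centrally_essential :: "'a::ab_group_add itself \<Rightarrow> bool" where
  "End_centrally_essential TYPE('a) \<longleftrightarrow>
     (\<forall>a\<in>(End_ring :: ('a \<Rightarrow> 'a) set). a \<noteq> (\<lambda>_. 0) \<longrightarrow>
        (\<exists>x\<in>End_center. \<exists>y\<in>End_center. x \<noteq> (\<lambda>_. 0) \<and> y \<noteq> (\<lambda>_. 0) \<and> a \<circ> x = y))"

end

theory Submission
  imports Defs "HOL-Library.Product_Plus"
begin

text \<open>
  In a centrally essential ring every idempotent e is central: a non-zero corner element
  a with e a = a and a e = 0 satisfies a x = y for central x and y \<noteq> 0, but then
  y = e y = y e = a x e = a e x = 0. If A = B + C is a direct decomposition, centrality of the
  projections leaves no non-zero homomorphism between B and C. As D(A) is injective, this makes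
  R(A) torsion, separates the primes of R(A) from those of D(A), and allows in D(A) either a single
  copy of Q or one quasi-cyclic group for each prime. A non-zero primary part of R(A) is not
  divisible, hence splits off a cyclic summand, which must be the whole part.

  Conversely, for groups of the stated form every endomorphism preserves D(A) and R(A) and acts on
  cyclic pieces by integers (on Q by rationals), so End A is commutative.
\<close>

section \<open>Integer multiples and extension of homomorphisms\<close>

text \<open>Homomorphisms between summands are tested on a single element. If the annihilator of x
  in the integers is contained in that of s, then x |-> s is well defined on the cyclic group of x,
  and the only question is whether it extends to all of A. For s in D(A) injectivity answers it. An
  x of infinite order then imposes no condition on s at all, which is why R(A) is torsion and why
  one copy of Q inside D(A) leaves room for nothing else there, quasi-cyclic groups included.

  Inside R(A) no injective target is at hand. The obstacle is to project A onto a cyclic group of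
  order p^(h+1); this works when its generator y comes from a socle element of finite p-height, z =
  p^h y with h maximal. Once the projection e onto that group exists, every w of order p in the
  kernel of e is hit by an endomorphism factoring through e, namely i y |-> i w after e.

  Both kinds of extension come from one Zorn argument, which asks for a solution d of n d = z only
  for the generator n of the ideal of multiples already constrained.\<close>

definition zmul :: "int \<Rightarrow> 'a::ab_group_add \<Rightarrow> 'a" where
  "zmul i x = (if i \<ge> 0 then nsmul (nat i) x else - nsmul (nat (- i)) x)"

lemma nsmul_add_left: "nsmul (m + n) x = nsmul m x + nsmul n x"
  by (induction m) (auto simp: add.assoc)

lemma nsmul_add_right: "nsmul n (x + y) = nsmul n x + nsmul n y"
  by (induction n) (auto simp: algebra_simps)

lemma nsmul_mult: "nsmul (m * n) x = nsmul m (nsmul n x)"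
  by (induction m) (auto simp: nsmul_add_left)

lemma nsmul_diff: "n \<le> m \<Longrightarrow> nsmul (m - n) x = nsmul m x - nsmul n x"
  using nsmul_add_left[of "m - n" n x] by simp

lemma zmul_int: "zmul (int n) x = nsmul n x"
  by (simp add: zmul_def)

lemma zmul_int_diff: "zmul (int m - int n) x = nsmul m x - nsmul n x"
proof (cases "n \<le> m")
  case True
  then have "zmul (int m - int n) x = nsmul (m - n) x"
    by (metis of_nat_diff zmul_int)
  with True show ?thesis by (simp add: nsmul_diff)
next
  case False
  then have "int m - int n < 0" and "nat (- (int m - int n)) = n - m" by auto
  then have "zmul (int m - int n) x = - nsmul (n - m) x"
    unfolding zmul_def by simp
  with False show ?thesis by (simp add: nsmul_diff)
qed

interpretation zm: module zmul
proof
  fix a b :: int and x y :: 'a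
  \<comment> \<open>Writing integers as differences of naturals avoids every case distinction on
    signs.\<close>
  obtain m n where a: "a = int m - int n" by (rule int_diff_cases)
  obtain m' n' where b: "b = int m' - int n'" by (rule int_diff_cases)
  show "zmul a (x + y) = zmul a x + zmul a y"
    unfolding a zmul_int_diff by (simp add: nsmul_add_right)
  have "a + b = int (m + m') - int (n + n')" by (simp add: a b)
  then have "zmul (a + b) x = nsmul (m + m') x - nsmul (n + n') x"
    by (simp only: zmul_int_diff)
  then show "zmul (a + b) x = zmul a x + zmul b x"
    unfolding a b zmul_int_diff by (simp add: nsmul_add_left)
  have minus: "nsmul k (u - v) = nsmul k u - nsmul k v" for k and u v :: 'a
    using nsmul_add_right[of k "u - v" v] by (simp add: algebra_simps)
  have "a * b = int (m * m' + n * n') - int (m * n' + n * m')"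
    by (simp add: a b algebra_simps)
  then have "zmul (a * b) x = nsmul (m * m' + n * n') x - nsmul (m * n' + n * m') x"
    by (simp only: zmul_int_diff)
  then show "zmul a (zmul b x) = zmul (a * b) x"
    unfolding a b zmul_int_diff by (simp add: nsmul_add_left nsmul_mult minus)
  show "zmul 1 x = x" by (simp add: zmul_def)
qed

lemma zmul_Pair: "zmul i (a, b) = (zmul i a, zmul i b)"
proof -
  have "nsmul n (a, b) = (nsmul n a, nsmul n b)" for n
    by (induction n) (auto simp: zero_prod_def)
  then show ?thesis by (simp add: zmul_def)
qed

lemma zmul_rat: "zmul i (q :: rat) = of_int i * q"
proof -
  have "nsmul n q = of_nat n * q" for n by (induction n) (auto simp: algebra_simps)
  then show ?thesis by (simp add: zmul_def)
qed

lemma additive_zmul: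
  assumes "additive f"
  shows "f (zmul i x) = zmul i (f x)"
proof -
  interpret additive f by fact
  have "f (nsmul n x) = nsmul n (f x)" for n by (induction n) (auto simp: add zero)
  then show ?thesis by (simp add: zmul_def minus)
qed

lemma End_ring_iff: "f \<in> End_ring \<longleftrightarrow> additive f"
  by (simp add: End_ring_def additive_def)

lemma additive_id_diff: "additive e \<Longrightarrow> additive (\<lambda>x. x - e x)"
  by (simp add: additive_def)

lemma subgrp_0: "subgrp S \<Longrightarrow> 0 \<in> S"
  and subgrp_add: "subgrp S \<Longrightarrow> x \<in> S \<Longrightarrow> y \<in> S \<Longrightarrow> x + y \<in> S"
  and subgrp_minus: "subgrp S \<Longrightarrow> x \<in> S \<Longrightarrow> - x \<in> S"
  by (auto simp: subgrp_def)

lemma subgrp_diff: "subgrp S \<Longrightarrow> x \<in> S \<Longrightarrow> y \<in> S \<Longrightarrow> x - y \<in> S"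
  using subgrp_add[of S x "- y"] subgrp_minus[of S y] by simp

lemma subgrp_zmul:
  assumes "subgrp S" "x \<in> S"
  shows "zmul i x \<in> S"
proof -
  have "nsmul n x \<in> S" for n by (induction n) (auto simp: assms subgrp_0 subgrp_add)
  then show ?thesis by (simp add: zmul_def assms(1) subgrp_minus)
qed

lemma subgrp_sum: "subgrp S \<Longrightarrow> (\<And>i. i \<in> I \<Longrightarrow> f i \<in> S) \<Longrightarrow> sum f I \<in> S"
  by (induction I rule: infinite_finite_induct) (auto simp: subgrp_0 subgrp_add)

lemma subgrp_UNIV: "subgrp UNIV"
  by (simp add: subgrp_def)

lemma subgrp_multiples: "subgrp (range (\<lambda>i. zmul i x))"
  unfolding subgrp_def
proof (intro conjI ballI)
  show "0 \<in> range (\<lambda>i. zmul i x)" by (metis rangeI zm.scale_zero_left)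
qed (auto simp flip: zm.scale_left_distrib zm.scale_minus_left)

lemma zmul_coprime_eq_0:
  assumes "coprime m n" "zmul m x = 0" "zmul n x = 0"
  shows "x = 0"
proof -
  obtain u v where "u * m + v * n = 1" using assms(1) by (metis bezout_int coprime_iff_gcd_eq_1)
  then have "x = zmul (u * m + v * n) x" by simp
  also have "\<dots> = zmul u (zmul m x) + zmul v (zmul n x)"
    by (simp only: zm.scale_left_distrib zm.scale_scale)
  finally show ?thesis by (simp add: assms)
qed

text \<open>Elements of the same prime order thus have the same annihilator, so either may be sent
  to the other. This separates the primes of the two summands and bounds the socle within one
  primary part.\<close>

lemma zmul_order_prime_iff:
  assumes "prime p" "x \<noteq> 0" "zmul (int p) x = 0"
  shows "zmul i x = 0 \<longleftrightarrow> int p dvd i"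
proof
  assume "zmul i x = 0"
  show "int p dvd i"
  proof (rule ccontr)
    assume "\<not> int p dvd i"
    then have "coprime (int p) i" using assms(1) by (simp add: prime_imp_coprime)
    then show False using zmul_coprime_eq_0 assms \<open>zmul i x = 0\<close> by blast
  qed
next
  assume "int p dvd i"
  then obtain j where "i = j * int p" by (metis dvd_def mult.commute)
  then show "zmul i x = 0" using assms(3) by (metis zm.scale_scale zm.scale_zero_right)
qed

text \<open>The last non-zero p-power multiple of x has order p; questions about p-primary elements
  are reduced to the socle in this way.\<close>

lemma zmul_prime_power_ex:
  assumes "zmul (int p ^ n) x = 0" "x \<noteq> 0"
  obtains m where "zmul (int p ^ m) x \<noteq> 0" "zmul (int p ^ Suc m) x = 0"
proof -
  define l where "l = (LEAST n. zmul (int p ^ n) x = 0)"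
  have l: "zmul (int p ^ l) x = 0" unfolding l_def by (rule LeastI) (rule assms(1))
  then have "l \<noteq> 0" using assms(2) by (cases "l = 0") auto
  then obtain m where m: "l = Suc m" using not0_implies_Suc by blast
  then have "zmul (int p ^ m) x \<noteq> 0"
    using not_less_Least[of m "\<lambda>n. zmul (int p ^ n) x = 0"] unfolding l_def by simp
  with l m that show ?thesis by blast
qed

section \<open>Divisible subgroups and the largest one among them\<close>

lemma divisible_subgrp_iff:
  "divisible_subgrp S \<longleftrightarrow> subgrp S \<and> (\<forall>x\<in>S. \<forall>n>0. \<exists>y\<in>S. zmul n y = x)"
proof -
  have "(\<forall>n>0. \<exists>y\<in>S. nsmul n y = x) \<longleftrightarrow> (\<forall>n>0. \<exists>y\<in>S. zmul n y = x)" for x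
    by (metis of_nat_0_less_iff zmul_int zero_less_imp_eq_int)
  then show ?thesis unfolding divisible_subgrp_def by simp
qed

lemma divisible_subgrpD:
  assumes "divisible_subgrp S"
  shows "subgrp S" "x \<in> S \<Longrightarrow> n > 0 \<Longrightarrow> \<exists>y\<in>S. zmul n y = x"
  using assms by (auto simp: divisible_subgrp_iff)

lemma additive_image_subgrp:
  assumes "additive f" "subgrp S"
  shows "subgrp (f ` S)"
proof -
  interpret additive f by fact
  show ?thesis unfolding subgrp_def
  proof (intro conjI ballI)
    show "0 \<in> f ` S" using zero subgrp_0[OF assms(2)] by force
  qed (use assms(2) in \<open>auto simp: add[symmetric] minus[symmetric] subgrp_add subgrp_minus\<close>)
qed

lemma additive_image_divisible:
  assumes "additive f" "divisible_subgrp S"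
  shows "divisible_subgrp (f ` S)"
  unfolding divisible_subgrp_iff
proof (intro conjI ballI allI impI)
  show "subgrp (f ` S)" using assms by (simp add: additive_image_subgrp divisible_subgrpD)
  fix x and n :: int
  assume "x \<in> f ` S" "n > 0"
  then show "\<exists>y\<in>f ` S. zmul n y = x"
    using divisible_subgrpD(2)[OF assms(2)] additive_zmul[OF assms(1)] by (metis imageE imageI)
qed

lemma subset_div_part: "divisible_subgrp S \<Longrightarrow> S \<subseteq> div_part"
  by (auto simp: div_part_def)

text \<open>A union of subgroups need not be closed under addition; here it is, because the sum of
  two divisible subgroups is again divisible.\<close>

lemma divisible_div_part: "divisible_subgrp (div_part :: 'a::ab_group_add set)"
proof -
  have sum: "x + y \<in> (div_part :: 'a set)" if xy: "x \<in> div_part" "y \<in> div_part" for x y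
  proof -
    obtain S T where S: "divisible_subgrp S" "x \<in> S" and T: "divisible_subgrp T" "y \<in> T"
      using xy by (auto simp: div_part_def)
    have "divisible_subgrp {s + t |s t. s \<in> S \<and> t \<in> T}"
      unfolding divisible_subgrp_iff subgrp_def
    proof (intro conjI ballI allI impI)
      show "0 \<in> {s + t |s t. s \<in> S \<and> t \<in> T}"
        using S T by (auto intro!: exI[of _ 0] simp: subgrp_0 divisible_subgrpD)
    next
      fix a b assume "a \<in> {s + t |s t. s \<in> S \<and> t \<in> T}" "b \<in> {s + t |s t. s \<in> S \<and> t \<in> T}"
      then obtain s t s' t' where "a = s + t" "b = s' + t'" "s \<in> S" "t \<in> T" "s' \<in> S" "t' \<in> T"
        by blast
      then have "a + b = (s + s') + (t + t')" "s + s' \<in> S" "t + t' \<in> T"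
        using S T by (auto simp: subgrp_add divisible_subgrpD)
      then show "a + b \<in> {s + t |s t. s \<in> S \<and> t \<in> T}" by blast
    next
      fix a assume "a \<in> {s + t |s t. s \<in> S \<and> t \<in> T}"
      then obtain s t where "a = s + t" "s \<in> S" "t \<in> T" by blast
      then have "- a = (- s) + (- t)" "- s \<in> S" "- t \<in> T"
        using S T by (auto simp: subgrp_minus divisible_subgrpD)
      then show "- a \<in> {s + t |s t. s \<in> S \<and> t \<in> T}" by blast
    next
      fix a and n :: int assume "a \<in> {s + t |s t. s \<in> S \<and> t \<in> T}" "n > 0"
      then obtain s t where a: "a = s + t" "s \<in> S" "t \<in> T" by blast
      obtain s' t' where "s' \<in> S" "zmul n s' = s" "t' \<in> T" "zmul n t' = t"
        using divisible_subgrpD(2)[OF S(1) a(2) \<open>n > 0\<close>] divisible_subgrpD(2)[OF T(1) a(3) \<open>n > 0\<close>]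
        by blast
      then have "s' + t' \<in> {s + t |s t. s \<in> S \<and> t \<in> T}" "zmul n (s' + t') = a"
        using a by (auto simp: zm.scale_right_distrib)
      then show "\<exists>y\<in>{s + t |s t. s \<in> S \<and> t \<in> T}. zmul n y = a" by blast
    qed
    moreover have "x + y \<in> {s + t |s t. s \<in> S \<and> t \<in> T}" using S T by blast
    ultimately show ?thesis using subset_div_part by blast
  qed
  have "divisible_subgrp {0 :: 'a}"
    by (auto simp: divisible_subgrp_iff subgrp_def)
  then have zero: "0 \<in> (div_part :: 'a set)" using subset_div_part by blast
  have rest: "(- x \<in> div_part) \<and> (n > 0 \<longrightarrow> (\<exists>y\<in>div_part. zmul n y = x))"
    if x: "x \<in> div_part" for x :: 'a and n
  proof -
    obtain S where S: "divisible_subgrp S" "x \<in> S" using x unfolding div_part_def by blast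
    then have "S \<subseteq> div_part" by (simp add: subset_div_part)
    with S show ?thesis by (meson divisible_subgrpD subgrp_minus subsetD)
  qed
  show ?thesis unfolding divisible_subgrp_iff subgrp_def using sum zero rest by blast
qed

text \<open>Partial homomorphisms are represented by their graphs, which are subgroups of the product.\<close>

definition graph_hom :: "('a::ab_group_add \<times> 'b::ab_group_add) set \<Rightarrow> bool" where
  "graph_hom G \<longleftrightarrow> subgrp G \<and> (\<forall>b. (0, b) \<in> G \<longrightarrow> b = 0)"

lemma graph_hom_unique:
  assumes "graph_hom G" "(a, b) \<in> G" "(a, c) \<in> G"
  shows "b = c"
proof -
  have "(a, b) - (a, c) \<in> G" using assms by (intro subgrp_diff) (auto simp: graph_hom_def)
  then show ?thesis using assms(1) by (auto simp: graph_hom_def)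
qed

lemma graph_hom_zmul: "graph_hom G \<Longrightarrow> (a, b) \<in> G \<Longrightarrow> (zmul i a, zmul i b) \<in> G"
  using subgrp_zmul[of G "(a, b)" i] by (simp add: graph_hom_def zmul_Pair)

lemma dvd_generator_ex:
  fixes I :: "int set"
  assumes "subgrp I"
  shows "\<exists>n\<in>I. n \<ge> 0 \<and> (\<forall>k\<in>I. n dvd k)"
proof (cases "\<exists>k\<in>I. k > 0")
  case False
  have "k = 0" if "k \<in> I" for k
  proof (rule ccontr)
    assume "k \<noteq> 0"
    then have "k > 0 \<or> - k > 0" by linarith
    then show False using False that subgrp_minus[OF assms] by blast
  qed
  then show ?thesis using subgrp_0[OF assms] by (intro bexI[of _ 0]) auto
next
  case True
  define n where "n = (LEAST m. m > 0 \<and> int m \<in> I)"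
  obtain k where "k \<in> I" "k > 0" using True by blast
  then have ex: "nat k > 0 \<and> int (nat k) \<in> I" by simp
  have n: "n > 0 \<and> int n \<in> I" unfolding n_def by (rule LeastI) (rule ex)
  have zm: "zmul i j = i * j" for i j :: int
  proof -
    have "nsmul n j = int n * j" for n by (induction n) (auto simp: algebra_simps)
    then show ?thesis by (simp add: zmul_def)
  qed
  have "int n dvd k" if "k \<in> I" for k
  proof -
    have "k mod int n = k - zmul (k div int n) (int n)"
      by (simp add: zm minus_div_mult_eq_mod)
    then have "k mod int n \<in> I" using that n assms by (simp add: subgrp_diff subgrp_zmul)
    moreover have "0 \<le> k mod int n" "k mod int n < int n" using n by simp_all
    ultimately have "\<not> 0 < k mod int n"
      using not_less_Least[of "nat (k mod int n)" "\<lambda>m. m > 0 \<and> int m \<in> I"] unfolding n_def[symmetric]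
      by auto
    then show ?thesis using \<open>0 \<le> k mod int n\<close> by (simp add: dvd_eq_mod_eq_0)
  qed
  then show ?thesis using n by (intro bexI[of _ "int n"]) auto
qed

lemma graph_hom_chain_Union:
  assumes "C \<noteq> {}" "subset.chain {G. graph_hom G \<and> G0 \<subseteq> G \<and> snd ` G \<subseteq> D} C"
  shows "graph_hom (\<Union>C)"
proof -
  have C: "graph_hom G" if "G \<in> C" for G using assms(2) that by (auto simp: subset.chain_def)
  have two: "\<exists>G\<in>C. a \<in> G \<and> b \<in> G" if ab: "a \<in> \<Union>C" "b \<in> \<Union>C" for a b
  proof -
    obtain G H where "G \<in> C" "a \<in> G" "H \<in> C" "b \<in> H" using ab by blast
    moreover from this have "G \<subseteq> H \<or> H \<subseteq> G"
      using assms(2) by (auto simp: subset_chain_def)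
    ultimately show ?thesis by blast
  qed
  show ?thesis unfolding graph_hom_def subgrp_def
  proof (intro conjI ballI allI impI)
    show "0 \<in> \<Union>C" using assms(1) C by (force simp: graph_hom_def subgrp_def)
    show "a + b \<in> \<Union>C" if "a \<in> \<Union>C" "b \<in> \<Union>C" for a b
      using two[OF that] C unfolding graph_hom_def subgrp_def by blast
    show "- a \<in> \<Union>C" if "a \<in> \<Union>C" for a
      using that C unfolding graph_hom_def subgrp_def by blast
    show "b = 0" if "(0, b) \<in> \<Union>C" for b
      using that C unfolding graph_hom_def by blast
  qed
qed

text \<open>Baer's argument with a weakened hypothesis. Instead of divisibility of D,
  \<open>step\<close> asks for a solution of n d = z only when n generates the ideal of multiples of
  x in the domain of G, and it may use that G extends \<open>G0\<close>. This covers a divisible D,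
  but also a cyclic D once \<open>G0\<close> restricts the possible n.\<close>

lemma extend_hom:
  fixes G0 :: "('a::ab_group_add \<times> 'b::ab_group_add) set"
  assumes G0: "graph_hom G0" "snd ` G0 \<subseteq> D" and D: "subgrp D"
    and step: "\<And>G x z n. \<lbrakk>graph_hom G; G0 \<subseteq> G; snd ` G \<subseteq> D; n > 0; (zmul n x, z) \<in> G;
        \<And>k w. (zmul k x, w) \<in> G \<Longrightarrow> n dvd k\<rbrakk> \<Longrightarrow> \<exists>d\<in>D. zmul n d = z"
  obtains f where "additive f" "range f \<subseteq> D" "\<And>x z. (x, z) \<in> G0 \<Longrightarrow> f x = z"
proof -
  let ?A = "{G. graph_hom G \<and> G0 \<subseteq> G \<and> snd ` G \<subseteq> D}"
  have "\<exists>M\<in>?A. \<forall>X\<in>?A. M \<subseteq> X \<longrightarrow> X = M"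
  proof (rule subset_Zorn_nonempty)
    show "?A \<noteq> {}" using G0 by blast
    fix C assume C: "C \<noteq> {}" "subset.chain ?A C"
    have "C \<subseteq> ?A" using C(2) by (simp add: subset_chain_def)
    then have "G0 \<subseteq> \<Union>C" "snd ` \<Union>C \<subseteq> D" using C(1) by blast+
    then show "\<Union>C \<in> ?A" using graph_hom_chain_Union[OF C] by simp
  qed
  then obtain G where GA: "G \<in> ?A" and Gmax: "\<forall>X\<in>?A. G \<subseteq> X \<longrightarrow> X = G"
    by (elim bexE)
  then have G: "graph_hom G" "G0 \<subseteq> G" "snd ` G \<subseteq> D" by simp_all
  have max: "X = G" if "graph_hom X" "G0 \<subseteq> X" "snd ` X \<subseteq> D" "G \<subseteq> X" for X
    using Gmax that by simp
  have sg: "subgrp G" using G(1) by (simp add: graph_hom_def)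
  have total: "\<exists>z. (x, z) \<in> G" for x
  proof -
    \<comment> \<open>The multiples of x in the domain form an ideal; its generator n yields the
      single equation that the new value at x has to satisfy.\<close>
    define I where "I = {k. \<exists>w. (zmul k x, w) \<in> G}"
    have "subgrp I" unfolding subgrp_def I_def
    proof (intro conjI ballI)
      show "0 \<in> {k. \<exists>w. (zmul k x, w) \<in> G}"
        using subgrp_0[OF sg] by (auto simp: zero_prod_def)
      show "a + b \<in> {k. \<exists>w. (zmul k x, w) \<in> G}"
        if "a \<in> {k. \<exists>w. (zmul k x, w) \<in> G}" "b \<in> {k. \<exists>w. (zmul k x, w) \<in> G}" for a b
        using that subgrp_add[OF sg] by (force simp: zm.scale_left_distrib)
      show "- a \<in> {k. \<exists>w. (zmul k x, w) \<in> G}"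
        if "a \<in> {k. \<exists>w. (zmul k x, w) \<in> G}" for a
        using that subgrp_minus[OF sg] by force
    qed
    from dvd_generator_ex[OF this] obtain n where n: "n \<in> I" "n \<ge> 0" and "\<forall>k\<in>I. n dvd k"
      by blast
    then have dvd: "n dvd k" if "(zmul k x, w) \<in> G" for k w
      using that unfolding I_def by blast
    obtain z where z: "(zmul n x, z) \<in> G" using n by (auto simp: I_def)
    obtain d where d: "d \<in> D" "zmul n d = z"
    proof (cases "n = 0")
      \<comment> \<open>No non-zero multiple of x is constrained, so 0 is as good a value as
        any.\<close>
      case True
      then have "z = 0" using z G(1) by (simp add: graph_hom_def)
      then show ?thesis using that[of 0] True subgrp_0[OF D] by simp
    next
      case False
      then have "n > 0" using n by simp
      have "\<exists>d\<in>D. zmul n d = z" by (rule step[OF G \<open>n > 0\<close> z]) (rule dvd)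
      then show ?thesis using that by blast
    qed
    let ?X = "{g + zmul i (x, d) |g i. g \<in> G}"
    have "graph_hom ?X" unfolding graph_hom_def subgrp_def
    proof (intro conjI ballI allI impI)
      have "0 + zmul 0 (x, d) \<in> ?X" using subgrp_0[OF sg] by blast
      then show "0 \<in> ?X" by simp
    next
      fix a b assume "a \<in> ?X" "b \<in> ?X"
      then obtain g h i j where "a = g + zmul i (x, d)" "b = h + zmul j (x, d)" "g \<in> G" "h \<in> G"
        by blast
      then have "a + b = (g + h) + zmul (i + j) (x, d)" "g + h \<in> G"
        using subgrp_add[OF sg] by (auto simp: zm.scale_left_distrib)
      then show "a + b \<in> ?X" by blast
    next
      fix a assume "a \<in> ?X"
      then obtain g i where "a = g + zmul i (x, d)" "g \<in> G" by blast
      then have "- a = - g + zmul (- i) (x, d)" "- g \<in> G"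
        using subgrp_minus[OF sg] by auto
      then show "- a \<in> ?X" by blast
    next
      fix b assume "(0, b) \<in> ?X"
      then obtain u v i where uv: "(u, v) \<in> G" "0 = u + zmul i x" "b = v + zmul i d"
        by (auto simp: zmul_Pair)
      \<comment> \<open>Single-valuedness of the enlarged graph: i x lies in the old domain, hence i
        is a multiple of n, and n d = z makes the old value at i x agree with i d.\<close>
      have "(zmul i x, - v) \<in> G"
        using subgrp_minus[OF sg uv(1)] uv(2) by (simp add: eq_neg_iff_add_eq_0 add.commute minus_unique)
      moreover from this obtain j where "i = j * n" using dvd by (metis dvd_def mult.commute)
      moreover have "(zmul (j * n) x, zmul (j * n) d) \<in> G"
        using graph_hom_zmul[OF G(1) z, of j] d(2) by (simp add: zm.scale_scale[symmetric] del: zm.scale_scale)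
      ultimately have "- v = zmul i d" using graph_hom_unique[OF G(1)] by blast
      then show "b = 0" using uv(3) by (metis add.right_inverse)
    qed
    moreover have sub: "G \<subseteq> ?X"
    proof
      fix g assume "g \<in> G"
      then have "g + zmul 0 (x, d) \<in> ?X" by blast
      then show "g \<in> ?X" by simp
    qed
    moreover have "snd ` ?X \<subseteq> D"
    proof
      fix b assume "b \<in> snd ` ?X"
      then obtain g i where g: "g \<in> G" "b = snd g + zmul i d" by (auto simp: zmul_Pair)
      then have "snd g \<in> D" using G(3) by blast
      then show "b \<in> D" using g d(1) D by (simp add: subgrp_add subgrp_zmul)
    qed
    ultimately have "?X = G" using G(2) by (intro max) auto
    moreover have "0 + zmul 1 (x, d) \<in> ?X" using subgrp_0[OF sg] by blast
    ultimately have "0 + zmul 1 (x, d) \<in> G" by simp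
    then show ?thesis by auto
  qed
  define f where "f x = (THE z. (x, z) \<in> G)" for x
  have f: "(x, f x) \<in> G" for x
  proof -
    obtain z where "(x, z) \<in> G" using total by blast
    moreover from this have "w = z" if "(x, w) \<in> G" for w
      by (rule graph_hom_unique[OF G(1) that])
    ultimately show ?thesis unfolding f_def by (rule theI)
  qed
  have fI: "f x = z" if "(x, z) \<in> G" for x z
    using graph_hom_unique[OF G(1) f that] .
  show ?thesis
  proof (rule that)
    show "additive f"
    proof
      fix x y
      show "f (x + y) = f x + f y" using subgrp_add[OF sg f[of x] f[of y]] by (intro fI) simp
    qed
    show "range f \<subseteq> D" using f G(3) by force
    show "f x = z" if "(x, z) \<in> G0" for x z using that G(2) fI by blast
  qed
qed

lemma extend_hom_divisible:
  assumes "graph_hom G0" "snd ` G0 \<subseteq> D" "divisible_subgrp D"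
  obtains f where "additive f" "range f \<subseteq> D" "\<And>x z. (x, z) \<in> G0 \<Longrightarrow> f x = z"
proof (rule extend_hom[OF assms(1,2)])
  show "subgrp D" using assms(3) by (rule divisible_subgrpD)
  show "\<exists>d\<in>D. zmul n d = z" if "snd ` G \<subseteq> D" "n > 0" "(zmul n x, z) \<in> G" for G x z n
    using that by (intro divisible_subgrpD(2)[OF assms(3)]) force+
qed (rule that)

lemma graph_hom_cyclic:
  assumes "\<And>i. zmul i x = 0 \<Longrightarrow> zmul i s = 0"
  shows "graph_hom (range (\<lambda>i. (zmul i x, zmul i s)))"
  using subgrp_multiples[of "(x, s)"] assms by (auto simp: graph_hom_def zmul_Pair)

text \<open>Inclusion of annihilators makes x |-> s well defined on the cyclic group of x, and
  divisibility of D extends it. This is the source of homomorphisms into the divisible part, and of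
  those from the rationals.\<close>

lemma hom_cyclic_divisible:
  assumes "\<And>i. zmul i x = 0 \<Longrightarrow> zmul i s = 0" "divisible_subgrp D" "s \<in> D"
  obtains f where "additive f" "range f \<subseteq> D" "f x = s"
proof -
  have "snd ` range (\<lambda>i. (zmul i x, zmul i s)) \<subseteq> D"
    using assms by (auto simp: subgrp_zmul divisible_subgrpD)
  then obtain f where f: "additive f" "range f \<subseteq> D"
      "\<And>a z. (a, z) \<in> range (\<lambda>i. (zmul i x, zmul i s)) \<Longrightarrow> f a = z"
    using extend_hom_divisible[OF graph_hom_cyclic[OF assms(1)] _ assms(2)] by blast
  have "(x, s) \<in> range (\<lambda>i. (zmul i x, zmul i s))" by (rule range_eqI[of _ _ 1]) simp
  with f that show ?thesis by blast
qed

section \<open>Central idempotents and primary decomposition\<close>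

lemma idempotent_corner_zero:
  fixes a e :: "'a::ab_group_add \<Rightarrow> 'a"
  assumes CE: "End_centrally_essential TYPE('a)" and ae: "additive a" "additive e"
    and ea: "\<And>x. e (a x) = a x" and a_e: "\<And>x. a (e x) = 0"
  shows "a x = 0"
proof (rule ccontr)
  assume "a x \<noteq> 0"
  then have "a \<noteq> (\<lambda>_. 0)" by auto
  then obtain c y where cy: "c \<in> End_center" "y \<in> End_center" "y \<noteq> (\<lambda>_. 0)" "a \<circ> c = y"
    using CE ae(1) unfolding End_centrally_essential_def by (auto simp: End_ring_iff)
  have c: "c (e z) = e (c z)" and y: "y (e z) = e (y z)" for z
    using cy(1,2) ae(2) by (auto simp: End_center_def End_ring_iff fun_eq_iff)
  have "y z = 0" for z
  proof -
    have "y z = e (y z)" using ea cy(4) by (metis comp_apply)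
    also have "\<dots> = a (c (e z))" using y cy(4) by (metis comp_apply)
    finally show ?thesis by (simp add: c a_e)
  qed
  then show False using cy(3) by auto
qed

text \<open>Both off-diagonal Peirce corners of g vanish: e g (1 - e) by the corner lemma for e, and
  (1 - e) g e by the same lemma for the complementary idempotent 1 - e.\<close>

lemma idempotent_central:
  fixes e g :: "'a::ab_group_add \<Rightarrow> 'a"
  assumes CE: "End_centrally_essential TYPE('a)" and eg: "additive e" "additive g"
    and idem: "\<And>x. e (e x) = e x"
  shows "e (g x) = g (e x)"
proof -
  interpret e: additive e by fact
  interpret g: additive g by fact
  have "e (g (x - e x)) = 0"
    by (rule idempotent_corner_zero[OF CE _ eg(1), of "\<lambda>x. e (g (x - e x))"])
      (simp_all add: additive_def idem e.add e.diff g.add g.diff e.zero g.zero)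
  moreover have "g (e x) - e (g (e x)) = 0"
    by (rule idempotent_corner_zero[OF CE, of "\<lambda>x. g (e x) - e (g (e x))" "\<lambda>x. x - e x"])
      (simp_all add: additive_def idem e.add e.diff g.add g.diff e.zero g.zero)
  ultimately show ?thesis by (simp add: e.diff g.diff)
qed

text \<open>The working form of "no homomorphism between summands" for a target in the divisible
  part: some g has g x = s, and commuting with e gives s = g (e x) = e (g x) = e s = 0.\<close>

lemma idempotent_separates:
  fixes e :: "'a::ab_group_add \<Rightarrow> 'a"
  assumes CE: "End_centrally_essential TYPE('a)" and e: "additive e" "\<And>x. e (e x) = e x"
    and "e x = x" "e s = 0" "s \<in> div_part" "\<And>i. zmul i x = 0 \<Longrightarrow> zmul i s = 0"
  shows "s = 0"
proof -
  obtain g where g: "additive g" "g x = s"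
    using hom_cyclic_divisible[OF _ divisible_div_part, of x s] assms by blast
  have "s = g (e x)" using assms(4) g(2) by simp
  also have "\<dots> = e s" using idempotent_central[OF CE e(1) g(1) e(2)] g(2) by metis
  finally show ?thesis using assms(5) by simp
qed

text \<open>The graph of the projection is written down directly. Its domain is already the whole
  group, so the extension theorem only converts the graph into a function.\<close>

lemma projection_ex:
  fixes R :: "'a::ab_group_add set"
  assumes "is_direct_complement (div_part :: 'a set) R"
  obtains e :: "'a \<Rightarrow> 'a" where "additive e" "range e \<subseteq> div_part"
    "\<And>x. x \<in> div_part \<Longrightarrow> e x = x" "\<And>x. x \<in> R \<Longrightarrow> e x = 0" "\<And>x. x - e x \<in> R"
proof -
  let ?D = "div_part :: 'a set"
  have R: "subgrp R" "?D \<inter> R = {0}" and sum: "\<And>a. \<exists>d\<in>?D. \<exists>r\<in>R. a = d + r"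
    using assms by (auto simp: is_direct_complement_def)
  have D: "subgrp ?D" using divisible_div_part by (rule divisible_subgrpD)
  let ?G = "{(d + r, d) |d r. d \<in> ?D \<and> r \<in> R}"
  have "graph_hom ?G" unfolding graph_hom_def subgrp_def
  proof (intro conjI ballI allI impI)
    have "(0 + 0, 0) \<in> ?G" using subgrp_0[OF D] subgrp_0[OF R(1)] by blast
    then show "0 \<in> ?G" by (simp add: zero_prod_def)
  next
    fix a b assume "a \<in> ?G" "b \<in> ?G"
    then obtain d r d' r' where "a = (d + r, d)" "b = (d' + r', d')" "d \<in> ?D" "r \<in> R" "d' \<in> ?D" "r' \<in> R"
      by blast
    then have "a + b = ((d + d') + (r + r'), d + d')" "d + d' \<in> ?D" "r + r' \<in> R"
      using D R(1) by (auto simp: subgrp_add)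
    then show "a + b \<in> ?G" by blast
  next
    fix a assume "a \<in> ?G"
    then obtain d r where "a = (d + r, d)" "d \<in> ?D" "r \<in> R" by blast
    then have "- a = ((- d) + (- r), - d)" "- d \<in> ?D" "- r \<in> R"
      using D R(1) by (auto simp: subgrp_minus)
    then show "- a \<in> ?G" by blast
  next
    fix b assume "(0, b) \<in> ?G"
    then obtain r where "0 = b + r" "b \<in> ?D" "r \<in> R" by blast
    then have "b = - r" by (metis add_eq_0_iff2)
    then have "b \<in> R" using \<open>r \<in> R\<close> R(1) by (simp add: subgrp_minus)
    then show "b = 0" using \<open>b \<in> ?D\<close> R(2) by blast
  qed
  moreover have "snd ` ?G \<subseteq> ?D" by auto
  ultimately obtain e where e: "additive e" "range e \<subseteq> ?D" "\<And>x z. (x, z) \<in> ?G \<Longrightarrow> e x = z"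
    using extend_hom_divisible[OF _ _ divisible_div_part] by blast
  have eq: "e (d + r) = d" if "d \<in> ?D" "r \<in> R" for d r using that by (intro e(3)) blast
  show ?thesis
  proof (rule that[OF e(1,2)])
    show "e x = x" if "x \<in> ?D" for x using eq[OF that subgrp_0[OF R(1)]] by simp
    show "e x = 0" if "x \<in> R" for x using eq[OF subgrp_0[OF D] that] by simp
    show "x - e x \<in> R" for x using sum[of x] eq by auto
  qed
qed

section \<open>Primary components of torsion groups\<close>

definition prim :: "nat \<Rightarrow> 'a::ab_group_add set \<Rightarrow> 'a set" where
  "prim p T = {t \<in> T. \<exists>n. zmul (int p ^ n) t = 0}"

lemma subgrp_prim:
  assumes "subgrp T"
  shows "subgrp (prim p T)"
  unfolding subgrp_def
proof (intro conjI ballI)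
  fix x y assume "x \<in> prim p T" "y \<in> prim p T"
  then obtain m n where mn: "x \<in> T" "y \<in> T" "zmul (int p ^ m) x = 0" "zmul (int p ^ n) y = 0"
    by (auto simp: prim_def)
  have "zmul (int p ^ (m + n)) (x + y)
      = zmul (int p ^ n) (zmul (int p ^ m) x) + zmul (int p ^ m) (zmul (int p ^ n) y)"
    by (simp add: zm.scale_right_distrib power_add mult.commute)
  then have "zmul (int p ^ (m + n)) (x + y) = 0" using mn by simp
  then show "x + y \<in> prim p T" using mn assms by (auto simp: prim_def subgrp_add)
qed (use assms in \<open>auto simp: prim_def subgrp_0 subgrp_minus\<close>)

text \<open>An induction principle replacing the primary decomposition. With N = p^a m and u p^a + v
  m = 1, x is the sum of u p^a x, which is killed by the smaller m, and v m x, which is p-primary.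
  The set E need only be closed under addition, so it can be an image or a set where two maps
  agree.\<close>

lemma mem_by_primary_parts:
  assumes T: "subgrp T" and E: "0 \<in> E" "\<And>x y. x \<in> E \<Longrightarrow> y \<in> E \<Longrightarrow> x + y \<in> E"
    and prim: "\<And>p. prime p \<Longrightarrow> prim p T \<subseteq> E"
    and "x \<in> T" "zmul (int N) x = 0" "N > 0"
  shows "x \<in> E"
  using assms(5-)
proof (induction N arbitrary: x rule: less_induct)
  case (less N)
  show ?case
  proof (cases "N = 1")
    case True
    then show ?thesis using less.prems E(1) by simp
  next
    case False
    then obtain p where p: "prime p" "p dvd N" using prime_factor_nat by blast
    define a where "a = multiplicity p N"
    obtain m where m: "N = p ^ a * m" "\<not> p dvd m"
      using multiplicity_decompose'[of N p] less.prems p(1) not_prime_unit[of p] unfolding a_def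
      by (metis gr_implies_not0)
    have "a > 0" using p m by (cases a) auto
    moreover have "m > 0" using m(2) by (cases m) auto
    ultimately have "m < N" using m(1) one_less_power[OF prime_gt_1_nat[OF p(1)]] by simp
    have "coprime (p ^ a) m" using p(1) m(2) by (simp add: prime_imp_coprime)
    then have "coprime (int p ^ a) (int m)" by (metis coprime_int_iff of_nat_power)
    then obtain u v where uv: "u * int p ^ a + v * int m = 1"
      by (metis bezout_int coprime_iff_gcd_eq_1)
    have N: "int N = int p ^ a * int m" using m(1) by simp
    have 1: "zmul (u * int p ^ a) x \<in> E"
    proof (rule less.IH[OF \<open>m < N\<close> _ _ \<open>m > 0\<close>])
      show "zmul (u * int p ^ a) x \<in> T" using less.prems T by (simp add: subgrp_zmul)
      have "int m * (u * int p ^ a) = u * int N" by (simp add: N)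
      then have "zmul (int m) (zmul (u * int p ^ a) x) = zmul u (zmul (int N) x)"
        by (simp only: zm.scale_scale)
      then show "zmul (int m) (zmul (u * int p ^ a) x) = 0" using less.prems by simp
    qed
    have "zmul (v * int m) x \<in> T" using less.prems T by (simp add: subgrp_zmul)
    moreover have "int p ^ a * (v * int m) = v * int N" by (simp add: N)
    then have "zmul (int p ^ a) (zmul (v * int m) x) = zmul v (zmul (int N) x)"
      by (simp only: zm.scale_scale)
    ultimately have "zmul (v * int m) x \<in> prim p T" using less.prems by (auto simp: prim_def)
    then have "zmul (u * int p ^ a) x + zmul (v * int m) x \<in> E" using prim[OF p(1)] E(2) 1 by blast
    then show ?thesis by (simp add: zm.scale_left_distrib[symmetric] uv)
  qed
qed

text \<open>Multiplying by the product N of the prime powers belonging to the other terms leaves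
  only N t_q, so t_q is killed both by N and by a power of q, and these are coprime.\<close>

lemma primary_parts_independent:
  assumes "finite B" "\<And>p. p \<in> B \<Longrightarrow> prime p" "\<And>p. p \<in> B \<Longrightarrow> t p \<in> prim p T"
    and sum: "(\<Sum>p\<in>B. t p) = 0" and q: "q \<in> B"
  shows "t q = 0"
proof -
  have "\<forall>p\<in>B. \<exists>n. zmul (int p ^ n) (t p) = 0" using assms(3) by (auto simp: prim_def)
  then obtain n where n: "\<And>p. p \<in> B \<Longrightarrow> zmul (int p ^ n p) (t p) = 0" by metis
  define N where "N = (\<Prod>p\<in>B - {q}. int p ^ n p)"
  have "zmul N (t p) = 0" if "p \<in> B - {q}" for p
  proof -
    have "int p ^ n p dvd N" unfolding N_def using that assms(1) by (intro dvd_prodI) auto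
    then obtain k where "N = k * int p ^ n p" by (metis dvd_def mult.commute)
    then have "zmul N (t p) = zmul k (zmul (int p ^ n p) (t p))" by (simp only: zm.scale_scale)
    then show ?thesis using n that by (simp del: zm.scale_scale)
  qed
  then have "(\<Sum>p\<in>B - {q}. zmul N (t p)) = 0" by simp
  moreover have "zmul N (t q) + (\<Sum>p\<in>B - {q}. zmul N (t p)) = zmul N (\<Sum>p\<in>B. t p)"
    by (simp add: sum.remove[OF assms(1) q] zm.scale_right_distrib zm.scale_sum_right)
  ultimately have "zmul N (t q) = 0" using sum by simp
  moreover have "coprime (int q ^ n q) N"
    unfolding N_def by (rule prod_coprime_right) (use assms(2) q in \<open>auto simp: primes_coprime\<close>)
  ultimately show ?thesis using n[OF q] zmul_coprime_eq_0 by blast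
qed

text \<open>The map is built from the model to T, where it is a finite sum of coordinate maps, and
  inverted at the end. Carriers and operations are parameters so that residues modulo p^k and
  fractions modulo 1 are handled by the same proof.\<close>

lemma iso_onto_by_primary_parts:
  fixes T :: "'a::ab_group_add set" and C :: "nat \<Rightarrow> 'c::zero set"
  assumes T: "subgrp T" and tors: "\<And>x. x \<in> T \<Longrightarrow> \<exists>N>0. zmul (int N) x = 0"
    and P: "\<And>p. p \<in> P \<Longrightarrow> prime p"
    and nP: "\<And>p. prime p \<Longrightarrow> p \<notin> P \<Longrightarrow> prim p T = {0}"
    and C0: "\<And>p. p \<in> P \<Longrightarrow> 0 \<in> C p" and phi0: "\<And>p. p \<in> P \<Longrightarrow> \<phi> p 0 = 0"
    and bij: "\<And>p. p \<in> P \<Longrightarrow> bij_betw (\<phi> p) (C p) (prim p T)"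
    and Cop: "\<And>p c d. p \<in> P \<Longrightarrow> c \<in> C p \<Longrightarrow> d \<in> C p \<Longrightarrow> op p c d \<in> C p"
    and phi: "\<And>p c d. p \<in> P \<Longrightarrow> c \<in> C p \<Longrightarrow> d \<in> C p \<Longrightarrow> \<phi> p (op p c d) = \<phi> p c + \<phi> p d"
    and op0: "\<And>p. p \<notin> P \<Longrightarrow> op p 0 0 = 0"
  shows "iso_onto T {f. finite {p. f p \<noteq> 0} \<and> (\<forall>p. f p \<noteq> 0 \<longrightarrow> p \<in> P) \<and> (\<forall>p\<in>P. f p \<in> C p)}
      (\<lambda>f g p. op p (f p) (g p))" (is "iso_onto T ?F ?op")
proof -
  define \<Psi> where "\<Psi> f = (\<Sum>p\<in>{p. f p \<noteq> 0}. \<phi> p (f p))" for f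
  \<comment> \<open>Any finite set of primes containing the support may be used; this gives
    functions with different supports a common index set.\<close>
  have \<Psi>: "\<Psi> f = (\<Sum>p\<in>B. \<phi> p (f p))" if "finite B" "{p. f p \<noteq> 0} \<subseteq> B" "B \<subseteq> P" for B f
    unfolding \<Psi>_def using that by (intro sum.mono_neutral_left) (auto simp: phi0)
  have phi_prim: "\<phi> p c \<in> prim p T" if "p \<in> P" "c \<in> C p" for p c
    using bij_betwE[OF bij[OF that(1)]] that(2) by blast
  have phi_inj: "c = d" if "p \<in> P" "c \<in> C p" "d \<in> C p" "\<phi> p c = \<phi> p d" for p c d
    using bij_betw_imp_inj_on[OF bij[OF that(1)]] that by (auto dest: inj_onD)
  \<comment> \<open>On P this follows from injectivity of \<open>\<phi> p\<close>, since both sides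
    are sent to 0. It keeps the support of a sum inside the union of the supports.\<close>
  have op00: "op p 0 0 = 0" for p
  proof (cases "p \<in> P")
    case True
    then show ?thesis using phi[OF True C0 C0] phi0[OF True] C0 Cop by (intro phi_inj[OF True]) auto
  qed (rule op0)
  have FD: "finite {p. f p \<noteq> 0}" "{p. f p \<noteq> 0} \<subseteq> P" "\<And>p. p \<in> P \<Longrightarrow> f p \<in> C p" if "f \<in> ?F" for f
    using that by auto
  have supp: "{p. ?op f g p \<noteq> 0} \<subseteq> {p. f p \<noteq> 0} \<union> {p. g p \<noteq> 0}" for f g
    using op00 by auto
  have opF: "?op f g \<in> ?F" if "f \<in> ?F" "g \<in> ?F" for f g
  proof -
    have "finite {p. ?op f g p \<noteq> 0}"
      using supp[of f g] FD(1)[OF that(1)] FD(1)[OF that(2)] by (meson finite_UnI finite_subset)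
    moreover have "{p. ?op f g p \<noteq> 0} \<subseteq> P"
      using supp[of f g] FD(2)[OF that(1)] FD(2)[OF that(2)] by blast
    ultimately show ?thesis using Cop FD(3)[OF that(1)] FD(3)[OF that(2)] by blast
  qed
  have \<Psi>_op: "\<Psi> (?op f g) = \<Psi> f + \<Psi> g" if fg: "f \<in> ?F" "g \<in> ?F" for f g
  proof -
    let ?B = "{p. f p \<noteq> 0} \<union> {p. g p \<noteq> 0}"
    have B: "finite ?B" "?B \<subseteq> P" using FD[OF fg(1)] FD[OF fg(2)] by auto
    have "\<Psi> (?op f g) = (\<Sum>p\<in>?B. \<phi> p (op p (f p) (g p)))"
      using \<Psi>[OF B(1) supp B(2)] .
    also have "\<dots> = (\<Sum>p\<in>?B. \<phi> p (f p) + \<phi> p (g p))"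
      using B(2) FD(3)[OF fg(1)] FD(3)[OF fg(2)] by (intro sum.cong phi) auto
    also have "\<dots> = \<Psi> f + \<Psi> g"
      using \<Psi>[OF B(1) _ B(2), of f] \<Psi>[OF B(1) _ B(2), of g] by (simp add: sum.distrib)
    finally show ?thesis .
  qed
  have \<Psi>T: "\<Psi> f \<in> T" if "f \<in> ?F" for f
    unfolding \<Psi>_def
  proof (rule subgrp_sum[OF T])
    fix p assume "p \<in> {p. f p \<noteq> 0}"
    then have "\<phi> p (f p) \<in> prim p T" using FD[OF that] by (intro phi_prim) auto
    then show "\<phi> p (f p) \<in> T" by (simp add: prim_def)
  qed
  have inj: "inj_on \<Psi> ?F"
  proof (rule inj_onI)
    fix f g assume fg: "f \<in> ?F" "g \<in> ?F" and eq: "\<Psi> f = \<Psi> g"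
    let ?B = "{p. f p \<noteq> 0} \<union> {p. g p \<noteq> 0}"
    have B: "finite ?B" "?B \<subseteq> P" using FD[OF fg(1)] FD[OF fg(2)] by auto
    have "(\<Sum>p\<in>?B. \<phi> p (f p) - \<phi> p (g p)) = 0"
      using \<Psi>[OF B(1) _ B(2), of f] \<Psi>[OF B(1) _ B(2), of g] eq by (simp add: sum_subtractf)
    moreover have "\<phi> p (f p) - \<phi> p (g p) \<in> prim p T" if "p \<in> ?B" for p
      using that B(2) FD(3)[OF fg(1)] FD(3)[OF fg(2)]
      by (intro subgrp_diff[OF subgrp_prim[OF T]] phi_prim) auto
    ultimately have "\<phi> p (f p) - \<phi> p (g p) = 0" if "p \<in> ?B" for p
      using primary_parts_independent[OF B(1), of "\<lambda>p. \<phi> p (f p) - \<phi> p (g p)" T p] P B(2) that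
      by blast
    then have "f p = g p" if "p \<in> ?B" for p
      using that B(2) FD(3)[OF fg(1)] FD(3)[OF fg(2)] by (intro phi_inj[of p]) auto
    then show "f = g" by (intro ext) (metis (mono_tags, lifting) UnCI mem_Collect_eq)
  qed
  have surj: "T \<subseteq> \<Psi> ` ?F"
  proof
    fix x assume x: "x \<in> T"
    obtain N where N: "N > 0" "zmul (int N) x = 0" using tors[OF x] by blast
    have zero: "(\<lambda>_. 0) \<in> ?F" "\<Psi> (\<lambda>_. 0) = 0" using C0 by (auto simp: \<Psi>_def)
    have prim: "prim p T \<subseteq> \<Psi> ` ?F" if p: "prime p" for p
    proof (cases "p \<in> P")
      case False
      then show ?thesis using nP[OF p] zero by (metis (no_types, lifting) empty_subsetI imageI insert_subset)
    next
      case True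
      show ?thesis
      proof
        fix t assume "t \<in> prim p T"
        then obtain c where c: "c \<in> C p" "t = \<phi> p c"
          using bij_betw_imp_surj_on[OF bij[OF True]] by blast
        let ?f = "(\<lambda>_. 0)(p := c)"
        have s: "{q. ?f q \<noteq> 0} \<subseteq> {p}" by auto
        then have "finite {q. ?f q \<noteq> 0}" by (rule finite_subset) simp
        then have "?f \<in> ?F" using True c C0 by auto
        moreover have "\<Psi> ?f = t" using \<Psi>[of "{p}" ?f] s True c by simp
        ultimately show "t \<in> \<Psi> ` ?F" by blast
      qed
    qed
    show "x \<in> \<Psi> ` ?F"
    proof (rule mem_by_primary_parts[OF T _ _ prim x N(2,1)])
      show "0 \<in> \<Psi> ` ?F" using zero by (metis (no_types, lifting) imageI)
      show "a + b \<in> \<Psi> ` ?F" if "a \<in> \<Psi> ` ?F" "b \<in> \<Psi> ` ?F" for a b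
      proof -
        obtain f g where "f \<in> ?F" "g \<in> ?F" "a = \<Psi> f" "b = \<Psi> g"
          using \<open>a \<in> \<Psi> ` ?F\<close> \<open>b \<in> \<Psi> ` ?F\<close> by (elim imageE)
        then have "a + b = \<Psi> (?op f g)" "?op f g \<in> ?F" using \<Psi>_op[of f g] opF[of f g] by simp_all
        then show ?thesis by (rule image_eqI)
      qed
    qed
  qed
  have b: "bij_betw \<Psi> ?F T"
    using inj surj \<Psi>T by (auto simp: bij_betw_def)
  show ?thesis unfolding iso_onto_def
  proof (intro exI conjI ballI)
    let ?h = "inv_into ?F \<Psi>"
    show "bij_betw ?h T ?F" by (rule bij_betw_inv_into[OF b])
    fix x y assume xy: "x \<in> T" "y \<in> T"
    have h: "?h z \<in> ?F" "\<Psi> (?h z) = z" if "z \<in> T" for z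
    proof -
      have "z \<in> \<Psi> ` ?F" using that surj by blast
      then show "?h z \<in> ?F" "\<Psi> (?h z) = z" by (rule inv_into_into, rule f_inv_into_f)
    qed
    have "\<Psi> (?op (?h x) (?h y)) = x + y"
      using \<Psi>_op[OF h(1)[OF xy(1)] h(1)[OF xy(2)]] h(2)[OF xy(1)] h(2)[OF xy(2)] by simp
    then show "?h (x + y) = ?op (?h x) (?h y)"
      using inv_into_f_f[OF inj opF[OF h(1)[OF xy(1)] h(1)[OF xy(2)]]] by simp
  qed
qed

section \<open>Cyclic summands of the reduced part\<close>

text \<open>The gcd of i and p^n is a power of p. On an element killed by p^n, multiplication by i
  can therefore be traded for multiplication by p^j and back.\<close>

lemma bezout_prime_power:
  fixes i :: int
  assumes "prime p"
  obtains j u v where "j \<le> n" "int p ^ j dvd i" "u * i + v * int p ^ n = int p ^ j"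
proof -
  have "prime (int p)" using assms by simp
  then obtain j where "j \<le> n" "gcd i (int p ^ n) = int p ^ j"
    using divides_primepow[of "int p" "gcd i (int p ^ n)" n] by auto
  moreover obtain u v where "u * i + v * int p ^ n = gcd i (int p ^ n)" using bezout_int by blast
  ultimately show ?thesis using that by (metis gcd_dvd1)
qed

text \<open>If i y = 0, then p^j y = 0 for the p^j that is the gcd of i and p^(h+1); as p^h y is
  non-zero, j must be h + 1.\<close>

lemma zmul_order_prime_power_iff:
  assumes p: "prime p" and y: "zmul (int p ^ h) y \<noteq> 0" "zmul (int p ^ Suc h) y = 0"
  shows "zmul i y = 0 \<longleftrightarrow> int p ^ Suc h dvd i"
proof
  assume i: "zmul i y = 0"
  obtain j u v where j: "j \<le> Suc h" "int p ^ j dvd i" "u * i + v * int p ^ Suc h = int p ^ j"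
    using bezout_prime_power[OF p] .
  have "zmul (int p ^ j) y = zmul u (zmul i y) + zmul v (zmul (int p ^ Suc h) y)"
    by (simp only: j(3)[symmetric] zm.scale_left_distrib zm.scale_scale)
  then have 0: "zmul (int p ^ j) y = 0" by (simp only: i y(2) zm.scale_zero_right add_0_left)
  have "\<not> j \<le> h"
  proof
    assume "j \<le> h"
    then have "zmul (int p ^ h) y = zmul (int p ^ (h - j)) (zmul (int p ^ j) y)"
      by (simp add: power_add[symmetric])
    then show False using y(1) 0 by (simp del: zm.scale_scale)
  qed
  then show "int p ^ Suc h dvd i" using j by (metis le_SucE)
next
  assume "int p ^ Suc h dvd i"
  then obtain k where "i = k * int p ^ Suc h" by (metis dvd_def mult.commute)
  then have "zmul i y = zmul k (zmul (int p ^ Suc h) y)" by (simp only: zm.scale_scale)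
  then show "zmul i y = 0" by (simp only: y(2) zm.scale_zero_right)
qed

text \<open>Divisibility by p suffices because an integer m prime to p acts invertibly on a p-group:
  on an element killed by p^c its inverse is the Bezout coefficient v with u p^c + v m = 1.\<close>

lemma divisible_prim:
  assumes T: "subgrp T" and p: "prime p" and div: "\<And>z. z \<in> prim p T \<Longrightarrow> \<exists>w\<in>prim p T. zmul (int p) w = z"
  shows "divisible_subgrp (prim p T)"
  unfolding divisible_subgrp_iff
proof (intro conjI ballI allI impI)
  show sg: "subgrp (prim p T)" using T by (rule subgrp_prim)
  fix z and n :: int
  assume z: "z \<in> prim p T" and n: "n > 0"
  have pow: "\<exists>w\<in>prim p T. zmul (int p ^ a) w = z" for a
  proof (induction a)
    case 0
    then show ?case using z by auto
  next
    case (Suc a)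
    then obtain w where "w \<in> prim p T" "zmul (int p ^ a) w = z" by blast
    moreover from this obtain w' where "w' \<in> prim p T" "zmul (int p) w' = w" using div by blast
    ultimately have "zmul (int p ^ Suc a) w' = z" "w' \<in> prim p T" by (auto simp: mult.commute)
    then show ?case by blast
  qed
  define a where "a = multiplicity p (nat n)"
  obtain m where m: "nat n = p ^ a * m" "\<not> p dvd m"
    using multiplicity_decompose'[of "nat n" p] n p not_prime_unit[of p] unfolding a_def
    by (metis not_less nat_0_iff)
  obtain w where w: "w \<in> prim p T" "zmul (int p ^ a) w = z" using pow by blast
  then obtain c where c: "zmul (int p ^ c) w = 0" by (auto simp: prim_def)
  have "coprime (p ^ c) m" using p m(2) by (simp add: prime_imp_coprime)
  then have "coprime (int p ^ c) (int m)" by (metis coprime_int_iff of_nat_power)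
  then obtain u v where uv: "u * int p ^ c + v * int m = 1"
    by (metis bezout_int coprime_iff_gcd_eq_1)
  have "n = int p ^ a * int m" using m(1) n by (metis int_nat_eq less_imp_le of_nat_mult of_nat_power)
  then have "zmul n (zmul v w) = zmul (int p ^ a) (zmul (v * int m) w)" by (simp add: mult_ac)
  also have "zmul (v * int m) w = zmul u (zmul (int p ^ c) w) + zmul (v * int m) w"
    by (simp only: c zm.scale_zero_right add_0_left)
  also have "\<dots> = w" by (simp add: zm.scale_left_distrib[symmetric] uv)
  finally show "\<exists>y\<in>prim p T. zmul n y = z" using w sg subgrp_zmul by blast
qed

text \<open>If all of the socle had infinite p-height in R, every p-primary element of R would be
  divisible by p, the primary part would be divisible, and x would lie in the divisible
  part.\<close>

lemma reduced_socle_height: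
  fixes R :: "'a::ab_group_add set"
  assumes R: "subgrp R" "div_part \<inter> R = {0}" and p: "prime p"
    and x: "x \<in> R" "x \<noteq> 0" "zmul (int p) x = 0"
  shows "\<exists>z\<in>R. \<exists>n. zmul (int p) z = 0 \<and> z \<notin> zmul (int p ^ n) ` R"
proof (rule ccontr)
  assume "\<not> ?thesis"
  then have all: "z \<in> zmul (int p ^ n) ` R" if "z \<in> R" "zmul (int p) z = 0" for z n
    using that by blast
  have claim: "\<exists>w\<in>R. zmul (int p) w = z" if "z \<in> R" "zmul (int p ^ n) z = 0" for n z
    using that
  proof (induction n arbitrary: z)
    case 0
    then show ?case using subgrp_0[OF R(1)] by (intro bexI[of _ 0]) auto
  next
    case (Suc n)
    have "zmul (int p ^ n) z \<in> R" "zmul (int p) (zmul (int p ^ n) z) = 0"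
      using Suc.prems R(1) by (auto simp: subgrp_zmul)
    then obtain w where w: "w \<in> R" "zmul (int p ^ n) z = zmul (int p ^ Suc n) w" using all by blast
    \<comment> \<open>The socle element p^n z equals p^(n+1) w, so z - p w has smaller exponent and
      falls under the induction hypothesis; adding p w back keeps divisibility by p.\<close>
    have "zmul (int p ^ n) (z - zmul (int p) w) = 0"
      using w by (simp add: zm.scale_right_diff_distrib mult.commute)
    moreover have "z - zmul (int p) w \<in> R" using Suc.prems w R(1) by (simp add: subgrp_diff subgrp_zmul)
    ultimately obtain w' where "w' \<in> R" "zmul (int p) w' = z - zmul (int p) w" using Suc.IH by blast
    then have "w' + w \<in> R" "zmul (int p) (w' + w) = z"
      using w R(1) by (auto simp: subgrp_add zm.scale_right_distrib)
    then show ?case by blast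
  qed
  have "divisible_subgrp (prim p R)"
  proof (rule divisible_prim[OF R(1) p])
    fix z assume "z \<in> prim p R"
    then obtain n where n: "z \<in> R" "zmul (int p ^ n) z = 0" by (auto simp: prim_def)
    then obtain w where w: "w \<in> R" "zmul (int p) w = z" using claim by blast
    then have "zmul (int p ^ Suc n) w = 0" using n(2) by (auto simp: mult.commute)
    then have "w \<in> prim p R" using w(1) unfolding prim_def by blast
    with w show "\<exists>w\<in>prim p R. zmul (int p) w = z" by blast
  qed
  moreover have "zmul (int p ^ 1) x = 0" using x by simp
  then have "x \<in> prim p R" using x(1) unfolding prim_def by blast
  ultimately have "x \<in> div_part" using subset_div_part by blast
  then show False using x R(2) by blast
qed

text \<open>The cyclic group generated by y is pure and bounded, so self-injectivity of
  the integers modulo a prime power makes it a direct summand.\<close>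

lemma cyclic_summand:
  fixes y :: "'a::ab_group_add"
  assumes p: "prime p" and y: "zmul (int p ^ Suc h) y = 0"
    and height: "zmul (int p ^ h) y \<notin> range (zmul (int p ^ Suc h))"
  obtains e where "additive e" "range e \<subseteq> range (\<lambda>i. zmul i y)" "e y = y"
proof -
  let ?q = "int p ^ Suc h" and ?C = "range (\<lambda>i. zmul i y)"
  have "zmul (int p ^ h) y \<noteq> 0"
  proof
    assume "zmul (int p ^ h) y = 0"
    then have "zmul (int p ^ h) y = zmul ?q 0" by simp
    then show False using height by blast
  qed
  note ord = zmul_order_prime_power_iff[OF p this y]
  \<comment> \<open>The partial map is the identity on the cyclic group and zero on p^(h+1) A. The
    second requirement bounds the extension problem: p^(h+1) x is in the domain for every x.\<close>
  let ?G0 = "{(zmul i y + zmul ?q a, zmul i y) |i a. True}"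
  have G0I: "(zmul i y + zmul ?q a, zmul i y) \<in> ?G0" for i a by blast
  have hom: "graph_hom ?G0" unfolding graph_hom_def subgrp_def
  proof (intro conjI ballI allI impI)
    show "0 \<in> ?G0" using G0I[of 0 0] by (simp add: zero_prod_def)
  next
    fix a b assume "a \<in> ?G0" "b \<in> ?G0"
    then obtain i j c d where "a = (zmul i y + zmul ?q c, zmul i y)" "b = (zmul j y + zmul ?q d, zmul j y)"
      by blast
    then have "a + b = (zmul (i + j) y + zmul ?q (c + d), zmul (i + j) y)"
      by (simp add: zm.scale_left_distrib zm.scale_right_distrib add_ac)
    then show "a + b \<in> ?G0" using G0I by simp
  next
    fix a assume "a \<in> ?G0"
    then obtain i c where "a = (zmul i y + zmul ?q c, zmul i y)" by blast
    then have "- a = (zmul (- i) y + zmul ?q (- c), zmul (- i) y)" by simp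
    then show "- a \<in> ?G0" using G0I[of "- i" "- c"] by simp
  next
    fix b assume "(0, b) \<in> ?G0"
    then obtain i a where ia: "0 = zmul i y + zmul ?q a" "b = zmul i y" by blast
    then have iy: "zmul i y = zmul ?q (- a)" by (metis add_eq_0_iff2 zm.scale_minus_right)
    obtain j u v where j: "j \<le> Suc h" "int p ^ j dvd i" "u * i + v * ?q = int p ^ j"
      using bezout_prime_power[OF p] .
    have "j = Suc h"
    proof (rule ccontr)
      \<comment> \<open>Purity of the cyclic group: if i y lies in p^(h+1) A without being 0, then
        so does p^j y for some j at most h, hence also p^h y, against the choice of height.\<close>
      assume "j \<noteq> Suc h"
      then have "j \<le> h" using j(1) by simp
      then have "zmul (int p ^ h) y = zmul (int p ^ (h - j)) (zmul (int p ^ j) y)"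
        by (simp add: power_add[symmetric])
      also have "zmul (int p ^ j) y = zmul u (zmul i y) + zmul v (zmul ?q y)"
        by (simp only: j(3)[symmetric] zm.scale_left_distrib zm.scale_scale)
      also have "\<dots> = zmul u (zmul ?q (- a))" by (simp only: y iy zm.scale_zero_right add_0_right)
      also have "zmul (int p ^ (h - j)) (zmul u (zmul ?q (- a))) = zmul ?q (zmul (int p ^ (h - j) * u) (- a))"
        by (simp only: zm.scale_scale mult_ac)
      finally show False using height by blast
    qed
    then show "b = 0" using j(2) ord ia(2) by blast
  qed
  have img: "snd ` ?G0 \<subseteq> ?C" by auto
  have step: "\<exists>d\<in>?C. zmul n d = z"
    if G: "graph_hom G" "?G0 \<subseteq> G" "snd ` G \<subseteq> ?C" "n > 0" "(zmul n x, z) \<in> G"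
      and dvd: "\<And>k w. (zmul k x, w) \<in> G \<Longrightarrow> n dvd k" for G x z n
  proof -
    \<comment> \<open>Since p^(h+1) x has value 0, n is some p^j. The value c y at n x is then
      killed by r = p^(h+1-j), so r n = p^(h+1) divides r c and n divides c. This is
      self-injectivity of the integers modulo p^(h+1).\<close>
    have "(zmul 0 y + zmul ?q x, zmul 0 y) \<in> G" using G(2) G0I[of 0 x] by (rule subsetD)
    then have px: "(zmul ?q x, 0) \<in> G" by (simp only: zm.scale_zero_left add_0_left)
    then have "n dvd ?q" using dvd by blast
    then obtain j where j: "j \<le> Suc h" "n = int p ^ j"
      using divides_primepow[of "int p" n "Suc h"] p \<open>n > 0\<close> by auto
    obtain c where c: "z = zmul c y" using G(3,5) by force
    define r where "r = int p ^ (Suc h - j)"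
    have r: "r * n = ?q" "r \<noteq> 0" using j p by (auto simp: r_def power_add[symmetric] prime_gt_0_nat)
    have "(zmul r (zmul n x), zmul r z) \<in> G" using graph_hom_zmul[OF G(1,5)] .
    then have "(zmul ?q x, zmul (r * c) y) \<in> G" using r(1) c by (simp only: zm.scale_scale)
    then have "zmul (r * c) y = 0" using graph_hom_unique[OF G(1) _ px] by blast
    then have "r * n dvd r * c" using ord r(1) by simp
    then have "n dvd c" using r(2) by simp
    then obtain k where "c = n * k" by blast
    then have "z = zmul n (zmul k y)" using c by simp
    then show ?thesis by blast
  qed
  obtain e where e: "additive e" "range e \<subseteq> ?C" "\<And>x z. (x, z) \<in> ?G0 \<Longrightarrow> e x = z"
    by (rule extend_hom[OF hom img subgrp_multiples step]) (assumption | rule that)+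
  have "e y = y" using e(3)[OF G0I[of 1 0]] by simp
  with e that show ?thesis by blast
qed

text \<open>A non-zero t - e t would have a last non-zero p-power multiple, an element of order p in
  T killed by e. So an idempotent whose kernel meets the socle of T trivially fixes the primary
  part.\<close>

lemma prim_complement_zero:
  assumes e: "additive e" "\<And>x. e (e x) = e x"
    and socle: "\<And>s. s \<in> T \<Longrightarrow> e s = 0 \<Longrightarrow> zmul (int p) s = 0 \<Longrightarrow> s = 0"
    and T: "subgrp T" "e t \<in> T" "t \<in> prim p T"
  shows "e t = t"
proof (rule ccontr)
  interpret additive e by fact
  assume "e t \<noteq> t"
  then have ne: "t - e t \<noteq> 0" by simp
  obtain n where n: "t \<in> T" "zmul (int p ^ n) t = 0" using T by (auto simp: prim_def)
  then have "zmul (int p ^ n) (t - e t) = 0"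
    by (simp add: zm.scale_right_diff_distrib additive_zmul[OF e(1), symmetric] zero)
  then obtain m where m: "zmul (int p ^ m) (t - e t) \<noteq> 0" "zmul (int p ^ Suc m) (t - e t) = 0"
    using zmul_prime_power_ex[OF _ ne] by blast
  let ?s = "zmul (int p ^ m) (t - e t)"
  have "?s \<in> T" using n(1) T by (simp add: subgrp_zmul subgrp_diff)
  moreover have "e ?s = 0" by (simp add: additive_zmul[OF e(1)] diff e(2))
  moreover have "zmul (int p) ?s = 0" using m(2) by simp
  ultimately show False using socle m(1) by blast
qed

lemma prim_ne_zero_ex:
  assumes "subgrp T" "prim p T \<noteq> {0}"
  obtains s where "s \<in> T" "s \<noteq> 0" "zmul (int p) s = 0"
proof -
  have "0 \<in> prim p T" using subgrp_0[OF subgrp_prim[OF assms(1)]] .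
  then obtain t where "t \<in> prim p T" "t \<noteq> 0" using assms(2) by blast
  then obtain n where n: "t \<in> T" "t \<noteq> 0" "zmul (int p ^ n) t = 0" by (auto simp: prim_def)
  then obtain m where "zmul (int p ^ m) t \<noteq> 0" "zmul (int p ^ Suc m) t = 0"
    using zmul_prime_power_ex by blast
  then show ?thesis using that[of "zmul (int p ^ m) t"] n(1) assms(1) by (simp add: subgrp_zmul)
qed

text \<open>A socle element of finite height is divided by p as often as possible; the quotient y
  generates a direct summand of A. Centrality of the projection e onto it leaves no element of order
  p in the kernel, so the summand is the whole primary part.\<close>

lemma reduced_primary_part_cyclic:
  fixes R :: "'a::ab_group_add set"
  assumes CE: "End_centrally_essential TYPE('a)" and DR: "is_direct_complement (div_part :: 'a set) R"
    and p: "prime p" and x: "x \<in> R" "x \<noteq> 0" "zmul (int p) x = 0"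
  obtains y k where "k > 0" "\<And>i. zmul i y = 0 \<longleftrightarrow> int p ^ k dvd i" "prim p R = range (\<lambda>i. zmul i y)"
proof -
  have R: "subgrp R" "div_part \<inter> R = {0}" using DR by (auto simp: is_direct_complement_def)
  obtain \<pi> where \<pi>: "additive \<pi>" "\<And>x. x \<in> R \<Longrightarrow> \<pi> x = 0" "\<And>x. x - \<pi> x \<in> R"
    using projection_ex[OF DR] by metis
  obtain z n where z: "z \<in> R" "zmul (int p) z = 0" "z \<notin> zmul (int p ^ n) ` R"
    using reduced_socle_height[OF R p x] by blast
  \<comment> \<open>N is the first exponent at which z stops being divisible. It is positive because
    z is in R, so N = h + 1 and z = p^h y with h the exact p-height of z in R.\<close>
  define N where "N = (LEAST n. z \<notin> zmul (int p ^ n) ` R)"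
  have N: "z \<notin> zmul (int p ^ N) ` R" unfolding N_def by (rule LeastI) (rule z(3))
  moreover have "z \<in> zmul (int p ^ 0) ` R" using z(1) by simp
  ultimately have "N \<noteq> 0" by metis
  then obtain h where h: "N = Suc h" using not0_implies_Suc by blast
  have "z \<in> zmul (int p ^ h) ` R"
    using not_less_Least[of h "\<lambda>n. z \<notin> zmul (int p ^ n) ` R"] h unfolding N_def by simp
  then obtain y where y: "y \<in> R" "z = zmul (int p ^ h) y" by blast
  have ann: "zmul (int p ^ Suc h) y = 0" using z(2) y(2) by simp
  have "z \<notin> range (zmul (int p ^ Suc h))"
  proof
    assume "z \<in> range (zmul (int p ^ Suc h))"
    then obtain a where a: "z = zmul (int p ^ Suc h) a" by blast
    \<comment> \<open>The height must be bounded in all of A, not only in R. The map 1 - \<pi> fixes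
      z and sends a to an element of R, which carries any divisibility in A back to R.\<close>
    have "z = z - \<pi> z" using \<pi>(2)[OF z(1)] by simp
    also have "\<dots> = zmul (int p ^ Suc h) (a - \<pi> a)"
      unfolding a by (simp only: additive_zmul[OF \<pi>(1)] zm.scale_right_diff_distrib)
    finally show False using \<pi>(3) N h by blast
  qed
  then have height: "zmul (int p ^ h) y \<notin> range (zmul (int p ^ Suc h))" using y(2) by simp
  obtain e where e: "additive e" "range e \<subseteq> range (\<lambda>i. zmul i y)" "e y = y"
    using cyclic_summand[OF p ann height] .
  interpret e: additive e by fact
  have ey: "e (zmul i y) = zmul i y" for i using e(3) by (simp add: additive_zmul[OF e(1)])
  have idem: "e (e x) = e x" for x
  proof -
    obtain i where "e x = zmul i y" using e(2) by blast
    then show ?thesis using ey by simp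
  qed
  have "zmul (int p ^ h) y \<noteq> 0"
  proof
    assume "zmul (int p ^ h) y = 0"
    then have "zmul (int p ^ h) y = zmul (int p ^ Suc h) 0" by simp
    then show False using height by blast
  qed
  note ord = zmul_order_prime_power_iff[OF p this ann]
  have "y \<in> prim p R" using ann y(1) unfolding prim_def by blast
  then have yp: "range (\<lambda>i. zmul i y) \<subseteq> prim p R"
    using subgrp_prim[OF R(1), of p] subgrp_zmul by blast
  have ker: "w = 0" if w: "e w = 0" "zmul (int p) w = 0" for w
  proof -
    \<comment> \<open>The graph of e followed by i y |-> i w. The target need not be divisible, so
      injectivity cannot supply this endomorphism; it exists because it factors through e, and it
      sends y to w.\<close>
    let ?G = "{(a, zmul i w) |a i. e a = zmul i y}"
    have wann: "zmul i w = 0" if "zmul i y = 0" for i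
    proof -
      have "int p dvd i" using that ord by (meson dvd_trans dvd_power zero_less_Suc)
      then obtain j where "i = j * int p" by (metis dvd_def mult.commute)
      then have "zmul i w = zmul j (zmul (int p) w)" by (simp only: zm.scale_scale)
      then show ?thesis using w(2) by (simp del: zm.scale_scale)
    qed
    have "graph_hom ?G" unfolding graph_hom_def subgrp_def
    proof (intro conjI ballI allI impI)
      have "(0, zmul 0 w) \<in> ?G" using e.zero by (metis (mono_tags, lifting) mem_Collect_eq zm.scale_zero_left)
      then show "0 \<in> ?G" by (simp add: zero_prod_def)
    next
      fix a b assume "a \<in> ?G" "b \<in> ?G"
      then obtain c d i j where "a = (c, zmul i w)" "b = (d, zmul j w)" "e c = zmul i y" "e d = zmul j y"
        by blast
      then have "a + b = (c + d, zmul (i + j) w)" "e (c + d) = zmul (i + j) y"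
        by (auto simp: e.add zm.scale_left_distrib)
      then show "a + b \<in> ?G" by blast
    next
      fix a assume "a \<in> ?G"
      then obtain c i where "a = (c, zmul i w)" "e c = zmul i y" by blast
      then have "- a = (- c, zmul (- i) w)" "e (- c) = zmul (- i) y" by (auto simp: e.minus)
      then show "- a \<in> ?G" by blast
    next
      fix b assume "(0, b) \<in> ?G"
      then obtain i where "b = zmul i w" "e 0 = zmul i y" by blast
      then show "b = 0" using e.zero wann by simp
    qed
    moreover have "\<exists>d\<in>UNIV. zmul m d = z"
      if "?G \<subseteq> G" "m > 0" "\<And>k w. (zmul k x, w) \<in> G \<Longrightarrow> m dvd k" for G x z m
    proof -
      \<comment> \<open>Every x already lies in the domain of the graph, which forces the generator
        to be 1 and makes the extension condition trivial.\<close>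
      obtain i where "e x = zmul i y" using e(2) by blast
      then have "(zmul 1 x, zmul i w) \<in> ?G" by auto
      then have "m dvd 1" using that(1,3) by blast
      then have "m = 1" using \<open>m > 0\<close> by simp
      then show ?thesis by auto
    qed
    ultimately obtain g where g: "additive g" "\<And>x z. (x, z) \<in> ?G \<Longrightarrow> g x = z"
      using extend_hom[of ?G UNIV] subgrp_UNIV by (metis (no_types, lifting) subset_UNIV)
    have "e y = zmul 1 y" using e(3) by simp
    then have "(y, zmul 1 w) \<in> ?G" by blast
    then have "g y = w" using g(2) by fastforce
    then have "w = g (e y)" using e(3) by simp
    also have "\<dots> = e w" using idempotent_central[OF CE e(1) g(1) idem] \<open>g y = w\<close> by metis
    finally show ?thesis using w by simp
  qed
  have "prim p R \<subseteq> range (\<lambda>i. zmul i y)"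
  proof
    fix t assume t: "t \<in> prim p R"
    have "e t \<in> R" using e(2) yp by (auto simp: prim_def)
    then have "e t = t" using prim_complement_zero[OF e(1) idem _ R(1) _ t] ker by blast
    then show "t \<in> range (\<lambda>i. zmul i y)" using e(2) by (metis rangeI subsetD)
  qed
  then show ?thesis using that[of "Suc h" y] ord yp by blast
qed

lemma cyclic_group_bij:
  assumes m: "m > 0" and ord: "\<And>i. zmul i y = 0 \<longleftrightarrow> m dvd i"
  shows "bij_betw (\<lambda>i. zmul i y) {0..<m} (range (\<lambda>i. zmul i y))"
    and "zmul (i mod m) y = zmul i y"
proof -
  have eq: "zmul i y = zmul j y \<longleftrightarrow> m dvd i - j" for i j
    using ord[of "i - j"] by (simp add: zm.scale_left_diff_distrib)
  show mod: "zmul (i mod m) y = zmul i y" for i by (simp add: eq mod_eq_dvd_iff[symmetric])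
  show "bij_betw (\<lambda>i. zmul i y) {0..<m} (range (\<lambda>i. zmul i y))"
    unfolding bij_betw_def
  proof
    show "inj_on (\<lambda>i. zmul i y) {0..<m}"
    proof (rule inj_onI)
      fix i j assume "i \<in> {0..<m}" "j \<in> {0..<m}" "zmul i y = zmul j y"
      then show "i = j" using eq[of i j] by (metis atLeastLessThan_iff mod_eq_dvd_iff mod_pos_pos_trivial)
    qed
    have "zmul i y \<in> (\<lambda>i. zmul i y) ` {0..<m}" for i
      using mod[of i] m by (intro image_eqI[of _ _ "i mod m"]) auto
    then show "(\<lambda>i. zmul i y) ` {0..<m} = range (\<lambda>i. zmul i y)" by blast
  qed
qed

section \<open>Structure of centrally essential endomorphism rings\<close>

lemma retraction_ex:
  assumes "divisible_subgrp S"
  obtains e where "additive e" "range e \<subseteq> S" "\<And>s. s \<in> S \<Longrightarrow> e s = s"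
proof -
  let ?G = "(\<lambda>s. (s, s)) ` S"
  have S: "subgrp S" using assms by (rule divisible_subgrpD)
  have "graph_hom ?G"
    unfolding graph_hom_def subgrp_def using S by (auto simp: zero_prod_def subgrp_0 subgrp_add subgrp_minus)
  moreover have "snd ` ?G \<subseteq> S" by auto
  ultimately obtain e where e: "additive e" "range e \<subseteq> S" "\<And>x z. (x, z) \<in> ?G \<Longrightarrow> e x = z"
    using extend_hom_divisible[OF _ _ assms] by blast
  have "e s = s" if "s \<in> S" for s by (rule e(3)) (use that in blast)
  with e that show ?thesis by blast
qed

text \<open>The map 1 |-> d extends to an embedding of Q, and its image is a direct summand of A. As
  d has trivial annihilator, it could be sent to any element of D(A) in the complement, so that part
  of D(A) is zero. Torsion next to Q is thereby excluded as well.\<close>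

lemma rational_component:
  fixes d :: "'a::ab_group_add"
  assumes CE: "End_centrally_essential TYPE('a)"
    and d: "d \<in> div_part" "\<And>i. zmul i d = 0 \<Longrightarrow> i = 0"
  shows "iso_onto (div_part :: 'a set) (UNIV :: rat set) (+)"
proof -
  let ?D = "div_part :: 'a set"
  have "zmul i d = 0" if "zmul i (1 :: rat) = 0" for i using that by (simp add: zmul_rat)
  then obtain \<phi> where \<phi>: "additive \<phi>" "range \<phi> \<subseteq> ?D" "\<phi> (1 :: rat) = d"
    using hom_cyclic_divisible[OF _ divisible_div_part d(1), of 1] by blast
  interpret \<phi>: additive \<phi> by fact
  have int: "\<phi> (of_int i) = zmul i d" for i
    using additive_zmul[OF \<phi>(1), of i 1] \<phi>(3) by (simp add: zmul_rat)
  have inj: "q = 0" if "\<phi> q = 0" for q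
  proof -
    \<comment> \<open>Clearing the denominator turns a kernel element into an integer multiple of d,
      and d has infinite order.\<close>
    obtain a b where ab: "b > 0" "q = of_int a / of_int b" by (metis quotient_of_div quotient_of_denom_pos surj_pair)
    then have "of_int a = zmul b q" by (simp add: zmul_rat)
    then have "zmul a d = zmul b (\<phi> q)" using int[of a] additive_zmul[OF \<phi>(1)] by simp
    then show ?thesis using that d(2) ab by simp
  qed
  have div: "divisible_subgrp (range \<phi>)"
  proof (rule additive_image_divisible[OF \<phi>(1)])
    have "\<exists>y. zmul n y = x" if "n > 0" for n and x :: rat
      using that by (intro exI[of _ "x / of_int n"]) (simp add: zmul_rat)
    then show "divisible_subgrp (UNIV :: rat set)" by (simp add: divisible_subgrp_iff subgrp_UNIV)
  qed
  obtain e where e: "additive e" "range e \<subseteq> range \<phi>" "\<And>s. s \<in> range \<phi> \<Longrightarrow> e s = s"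
    using retraction_ex[OF div] by blast
  have idem: "e (e x) = e x" for x using e(2,3) by blast
  interpret e: additive e by fact
  have "x \<in> range \<phi>" if x: "x \<in> ?D" for x
  proof -
    have "e x \<in> ?D" using e(2) \<phi>(2) by blast
    then have "x - e x \<in> ?D" by (rule subgrp_diff[OF divisible_subgrpD(1)[OF divisible_div_part] x])
    moreover have "e d = d" using e(3) \<phi>(3) by blast
    moreover have "zmul i (x - e x) = 0" if "zmul i d = 0" for i using d(2)[OF that] by simp
    ultimately have "x - e x = 0"
      using idempotent_separates[OF CE e(1) idem, of d "x - e x"] by (simp add: e.diff idem)
    then have "x = e x" by simp
    then show ?thesis using e(2) by blast
  qed
  then have D: "?D = range \<phi>" using \<phi>(2) by blast
  have "inj \<phi>" using inj \<phi>.diff by (intro injI) (metis eq_iff_diff_eq_0)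
  then have b: "bij_betw (inv \<phi>) ?D UNIV" using D by (metis bij_betw_inv_into inj_on_imp_bij_betw)
  have "inv \<phi> (x + y) = inv \<phi> x + inv \<phi> y" if "x \<in> ?D" "y \<in> ?D" for x y
  proof -
    obtain a b where "x = \<phi> a" "y = \<phi> b" using \<open>x \<in> ?D\<close> \<open>y \<in> ?D\<close> D by blast
    then show ?thesis using \<open>inj \<phi>\<close> by (simp add: \<phi>.add[symmetric])
  qed
  with b show ?thesis by (auto simp: iso_onto_def)
qed

text \<open>The group Z[1/p]; its quotient by the integers is the quasi-cyclic p-group, with
  representatives in [0,1).\<close>

definition prime_power_fracs :: "nat \<Rightarrow> rat set" where
  "prime_power_fracs p = {q. \<exists>n. q * of_nat (p ^ n) \<in> \<int>}"

lemma subgrp_prime_power_fracs: "subgrp (prime_power_fracs p)"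
  unfolding subgrp_def
proof (intro conjI ballI)
  fix x y assume "x \<in> prime_power_fracs p" "y \<in> prime_power_fracs p"
  then obtain m n where "x * of_nat (p ^ m) \<in> \<int>" "y * of_nat (p ^ n) \<in> \<int>"
    by (auto simp: prime_power_fracs_def)
  then have "(x * of_nat (p ^ m)) * of_nat (p ^ n) + (y * of_nat (p ^ n)) * of_nat (p ^ m) \<in> \<int>"
    by (meson Ints_add Ints_mult Ints_of_nat)
  then have "(x + y) * of_nat (p ^ (m + n)) \<in> \<int>" by (simp add: power_add algebra_simps)
  then show "x + y \<in> prime_power_fracs p" unfolding prime_power_fracs_def by blast
qed (auto simp: prime_power_fracs_def)

text \<open>An extension of 1/p |-> d to Q kills the integers because p d = 0, and it kills nothing
  else in Z[1/p]. The image of Z[1/p] is therefore quasi-cyclic and splits off; an element of order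
  p in the kernel of the retraction could be reached from d, so it must vanish.\<close>

lemma prufer_component:
  fixes d :: "'a::ab_group_add"
  assumes CE: "End_centrally_essential TYPE('a)" and p: "prime p"
    and d: "d \<in> div_part" "d \<noteq> 0" "zmul (int p) d = 0"
  obtains \<phi> :: "rat \<Rightarrow> 'a" where "additive \<phi>" "\<And>i. \<phi> (of_int i) = 0"
    "bij_betw \<phi> {q \<in> prime_power_fracs p. 0 \<le> q \<and> q < 1} (prim p div_part)"
proof -
  let ?D = "div_part :: 'a set" and ?Z = "prime_power_fracs p"
  have p0: "p > 0" using p by (rule prime_gt_0_nat)
  have Z: "subgrp ?Z" by (rule subgrp_prime_power_fracs)
  \<comment> \<open>Having infinite order in Q, 1/p may be sent to any element of the divisible
    part.\<close>
  have "zmul i d = 0" if "zmul i (1 / of_nat p :: rat) = 0" for i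
    using that p0 by (simp add: zmul_rat)
  then obtain \<phi> where \<phi>: "additive \<phi>" "range \<phi> \<subseteq> ?D" "\<phi> (1 / of_nat p :: rat) = d"
    using hom_cyclic_divisible[OF _ divisible_div_part d(1), of "1 / of_nat p"] by blast
  interpret \<phi>: additive \<phi> by fact
  have by_p: "\<phi> (of_int i / of_nat p) = zmul i d" for i
    using additive_zmul[OF \<phi>(1), of i "1 / of_nat p"] \<phi>(3) by (simp add: zmul_rat)
  have int: "\<phi> (of_int i) = 0" for i
  proof -
    have "\<phi> (of_int i) = zmul (i * int p) d" using by_p[of "i * int p"] p0 by simp
    also have "\<dots> = zmul i (zmul (int p) d)" by (simp only: zm.scale_scale)
    finally show ?thesis using d(3) by (simp del: zm.scale_scale)
  qed
  have Ints: "\<phi> q = 0" if "q \<in> \<int>" for q using that int by (metis Ints_cases)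
  \<comment> \<open>Induction on the exponent of the denominator: p q is an integer by the induction
    hypothesis, so q = i/p is sent to i d, and i d = 0 forces p to divide i.\<close>
  have ker: "q \<in> \<int>" if "q * of_nat (p ^ n) \<in> \<int>" "\<phi> q = 0" for q n
    using that
  proof (induction n arbitrary: q)
    case 0
    then show ?case by simp
  next
    case (Suc n)
    have "q * of_nat p = zmul (int p) q" by (simp add: zmul_rat)
    then have "\<phi> (q * of_nat p) = 0" using additive_zmul[OF \<phi>(1)] Suc.prems(2) by simp
    moreover have "(q * of_nat p) * of_nat (p ^ n) \<in> \<int>" using Suc.prems(1) by (simp add: mult_ac)
    ultimately have "q * of_nat p \<in> \<int>" using Suc.IH by blast
    then obtain i where "q * of_nat p = of_int i" by (elim Ints_cases)
    then have q: "q = of_int i / of_nat p" using p0 by (simp add: field_simps)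
    then have "int p dvd i" using by_p zmul_order_prime_iff[OF p d(2,3)] Suc.prems(2) by simp
    then obtain j where "i = int p * j" by blast
    then show ?case using q p0 by simp
  qed
  have kill: "zmul (int p ^ n) (\<phi> q) = 0" if "q * of_nat (p ^ n) \<in> \<int>" for q n
  proof -
    have "zmul (int p ^ n) q \<in> \<int>" using that by (simp add: zmul_rat mult.commute)
    then show ?thesis using Ints additive_zmul[OF \<phi>(1)] by metis
  qed
  let ?S = "\<phi> ` ?Z"
  have S: "subgrp ?S" using \<phi>(1) Z by (rule additive_image_subgrp)
  have SD: "?S \<subseteq> ?D" using \<phi>(2) by blast
  have "prim p ?S = ?S" using kill by (auto simp: prim_def prime_power_fracs_def)
  moreover have "\<exists>w\<in>?S. zmul (int p) w = z" if "z \<in> ?S" for z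
  proof -
    obtain q n where q: "z = \<phi> q" "q * of_nat (p ^ n) \<in> \<int>"
      using \<open>z \<in> ?S\<close> unfolding prime_power_fracs_def by blast
    then have "(q / of_nat p) * of_nat (p ^ Suc n) \<in> \<int>" using p0 by simp
    then have "q / of_nat p \<in> ?Z" unfolding prime_power_fracs_def by blast
    moreover have "zmul (int p) (\<phi> (q / of_nat p)) = z"
      using p0 q(1) by (simp add: additive_zmul[OF \<phi>(1), symmetric] zmul_rat)
    ultimately show ?thesis by blast
  qed
  ultimately have div: "divisible_subgrp ?S" using divisible_prim[OF S p] by simp
  obtain e where e: "additive e" "range e \<subseteq> ?S" "\<And>s. s \<in> ?S \<Longrightarrow> e s = s"
    using retraction_ex[OF div] by blast
  have idem: "e (e x) = e x" for x using e(2,3) by blast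
  have "1 / of_nat p * of_nat (p ^ 1) \<in> (\<int> :: rat set)" using p0 by simp
  then have "1 / of_nat p \<in> ?Z" unfolding prime_power_fracs_def by blast
  then have ed: "e d = d" using e(3) \<phi>(3) by blast
  have socle: "s = 0" if "s \<in> ?D" "e s = 0" "zmul (int p) s = 0" for s
  proof (rule ccontr)
    assume "s \<noteq> 0"
    then have "zmul i s = 0" if "zmul i d = 0" for i
      using that zmul_order_prime_iff[OF p d(2,3)] zmul_order_prime_iff[OF p \<open>s \<noteq> 0\<close>]
        \<open>zmul (int p) s = 0\<close> by blast
    then show False using idempotent_separates[OF CE e(1) idem ed \<open>e s = 0\<close> \<open>s \<in> ?D\<close>] \<open>s \<noteq> 0\<close> by blast
  qed
  have "prim p ?D \<subseteq> ?S"
  proof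
    fix t assume "t \<in> prim p ?D"
    then have "e t = t"
      using prim_complement_zero[OF e(1) idem socle divisible_subgrpD(1)[OF divisible_div_part]] e(2) SD
      by blast
    then show "t \<in> ?S" using e(2) by (metis rangeI subsetD)
  qed
  moreover have "?S \<subseteq> prim p ?D" using SD kill by (auto simp: prim_def prime_power_fracs_def)
  ultimately have eq: "prim p ?D = ?S" by blast
  let ?C = "{q \<in> ?Z. 0 \<le> q \<and> q < 1}"
  have "inj_on \<phi> ?C"
  proof (rule inj_onI)
    fix q r assume qr: "q \<in> ?C" "r \<in> ?C" "\<phi> q = \<phi> r"
    then have "q - r \<in> ?Z" "\<phi> (q - r) = 0" using Z by (auto simp: subgrp_diff \<phi>.diff)
    then have "q - r \<in> \<int>" unfolding prime_power_fracs_def using ker by blast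
    then obtain i where i: "q - r = of_int i" by (elim Ints_cases)
    \<comment> \<open>Two points of [0,1) that differ by an integer coincide.\<close>
    moreover have "of_int (- 1) < q - r" "q - r < of_int 1" using qr by auto
    ultimately have "- 1 < i" "i < 1" by (simp_all only: of_int_less_iff)
    then have "i = 0" by linarith
    then show "q = r" using i by simp
  qed
  moreover have "?S \<subseteq> \<phi> ` ?C"
  proof
    fix t assume "t \<in> ?S"
    then obtain q where q: "q \<in> ?Z" "t = \<phi> q" by blast
    have "of_int \<lfloor>q\<rfloor> * of_nat (p ^ 0) \<in> (\<int> :: rat set)" by simp
    then have "of_int \<lfloor>q\<rfloor> \<in> ?Z" unfolding prime_power_fracs_def by blast
    then have "frac q \<in> ?C" using q(1) Z by (simp add: frac_def subgrp_diff frac_lt_1[unfolded frac_def])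
    moreover have "t = \<phi> (frac q)" using q(2) int by (simp add: frac_def \<phi>.diff)
    ultimately show "t \<in> \<phi> ` ?C" by blast
  qed
  ultimately have "bij_betw \<phi> ?C (prim p ?D)" using eq by (auto simp: bij_betw_def)
  with \<phi>(1) int that show ?thesis by blast
qed

section \<open>Assembling primary parts into the two concrete direct sums\<close>

lemma cyc_sum_iso:
  fixes R :: "'a::ab_group_add set"
  assumes R: "subgrp R" "\<And>x. x \<in> R \<Longrightarrow> \<exists>N>0. zmul (int N) x = 0"
    and P: "\<And>p. p \<in> P \<Longrightarrow> prime p" "\<And>p. prime p \<Longrightarrow> p \<notin> P \<Longrightarrow> prim p R = {0}"
    and y: "\<And>p i. p \<in> P \<Longrightarrow> zmul i (y p) = 0 \<longleftrightarrow> int p ^ k p dvd i"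
      "\<And>p. p \<in> P \<Longrightarrow> prim p R = range (\<lambda>i. zmul i (y p))"
  shows "iso_onto R (cyc_sum P k) (cyc_sum_add k)"
proof -
  have pos: "int p ^ k p > 0" if "p \<in> P" for p using P(1)[OF that] by (simp add: prime_gt_0_nat)
  let ?C = "\<lambda>p. {0..<int p ^ k p}"
  let ?op = "\<lambda>p c d. (c + d) mod (int p ^ k p)"
  have "iso_onto R {f. finite {p. f p \<noteq> 0} \<and> (\<forall>p. f p \<noteq> 0 \<longrightarrow> p \<in> P) \<and> (\<forall>p\<in>P. f p \<in> ?C p)}
      (\<lambda>f g p. ?op p (f p) (g p))"
    by (rule iso_onto_by_primary_parts[where \<phi> = "\<lambda>p i. zmul i (y p)"])
      (use R P pos y cyclic_group_bij[OF pos y(1)] in \<open>auto simp: zm.scale_left_distrib\<close>)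
  moreover have "{f. finite {p. f p \<noteq> 0} \<and> (\<forall>p. f p \<noteq> 0 \<longrightarrow> p \<in> P) \<and> (\<forall>p\<in>P. f p \<in> ?C p)} = cyc_sum P k"
    by (auto simp: cyc_sum_def)
  moreover have "(\<lambda>f g p. ?op p (f p) (g p)) = cyc_sum_add k"
    by (auto simp: cyc_sum_add_def fun_eq_iff)
  ultimately show ?thesis by simp
qed

lemma prufer_sum_iso:
  fixes D :: "'a::ab_group_add set"
  assumes D: "subgrp D" "\<And>x. x \<in> D \<Longrightarrow> \<exists>N>0. zmul (int N) x = 0"
    and P: "\<And>p. p \<in> P \<Longrightarrow> prime p" "\<And>p. prime p \<Longrightarrow> p \<notin> P \<Longrightarrow> prim p D = {0}"
    and \<phi>: "\<And>p. p \<in> P \<Longrightarrow> additive (\<phi> p)" "\<And>p i. p \<in> P \<Longrightarrow> \<phi> p (of_int i) = 0"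
      "\<And>p. p \<in> P \<Longrightarrow> bij_betw (\<phi> p) {q \<in> prime_power_fracs p. 0 \<le> q \<and> q < 1} (prim p D)"
  shows "iso_onto D (prufer_sum P) prufer_sum_add"
proof -
  let ?C = "\<lambda>p. {q \<in> prime_power_fracs p. 0 \<le> q \<and> q < 1}"
  let ?op = "\<lambda>p c d. frac (c + d) :: rat"
  have frac: "frac q \<in> prime_power_fracs p" if "q \<in> prime_power_fracs p" for q p
  proof -
    have "of_int \<lfloor>q\<rfloor> * of_nat (p ^ 0) \<in> (\<int> :: rat set)" by simp
    then have "of_int \<lfloor>q\<rfloor> \<in> prime_power_fracs p" unfolding prime_power_fracs_def by blast
    then show ?thesis using that subgrp_prime_power_fracs by (simp add: frac_def subgrp_diff)
  qed
  have "iso_onto D {f. finite {p. f p \<noteq> 0} \<and> (\<forall>p. f p \<noteq> 0 \<longrightarrow> p \<in> P) \<and> (\<forall>p\<in>P. f p \<in> ?C p)}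
      (\<lambda>f g p. ?op p (f p) (g p))"
  proof (rule iso_onto_by_primary_parts[where \<phi> = \<phi>, OF D P _ _ \<phi>(3)])
    show "0 \<in> ?C p" for p using subgrp_0[OF subgrp_prime_power_fracs] by simp
    show "\<phi> p 0 = 0" if "p \<in> P" for p using \<phi>(2)[OF that, of 0] by simp
    show "?op p c d \<in> ?C p" if "c \<in> ?C p" "d \<in> ?C p" for p c d
      using that by (simp add: frac frac_lt_1 subgrp_add[OF subgrp_prime_power_fracs])
    show "\<phi> p (?op p c d) = \<phi> p c + \<phi> p d" if "p \<in> P" for p c d
      using \<phi>(2)[OF that] additive.add[OF \<phi>(1)[OF that]] additive.diff[OF \<phi>(1)[OF that]]
      by (simp add: frac_def)
  qed auto
  moreover have "{f. finite {p. f p \<noteq> 0} \<and> (\<forall>p. f p \<noteq> 0 \<longrightarrow> p \<in> P) \<and> (\<forall>p\<in>P. f p \<in> ?C p)} = prufer_sum P"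
    by (auto simp: prufer_sum_def prime_power_fracs_def)
  moreover have "(\<lambda>f g p. ?op p (f p) (g p)) = prufer_sum_add"
    by (auto simp: prufer_sum_add_def fun_eq_iff)
  ultimately show ?thesis by simp
qed

lemma structure_if_centrally_essential:
  fixes R :: "'a::ab_group_add set"
  assumes CE: "End_centrally_essential TYPE('a)"
    and DR: "is_direct_complement (div_part :: 'a set) R" and D0: "(div_part :: 'a set) \<noteq> {0}"
  shows "\<exists>P1 k. (\<forall>p\<in>P1. prime p \<and> k p > 0) \<and> iso_onto R (cyc_sum P1 k) (cyc_sum_add k) \<and>
       (iso_onto (div_part :: 'a set) (UNIV :: rat set) (+) \<or>
        (\<exists>P2. (\<forall>p\<in>P2. prime p) \<and> P1 \<inter> P2 = {} \<and>
           iso_onto (div_part :: 'a set) (prufer_sum P2) prufer_sum_add))"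
proof -
  let ?D = "div_part :: 'a set"
  have R: "subgrp R" using DR by (simp add: is_direct_complement_def)
  have D: "subgrp ?D" using divisible_div_part by (rule divisible_subgrpD)
  obtain \<pi> where \<pi>: "additive \<pi>" "range \<pi> \<subseteq> ?D" "\<And>x. x \<in> ?D \<Longrightarrow> \<pi> x = x" "\<And>x. x \<in> R \<Longrightarrow> \<pi> x = 0"
    using projection_ex[OF DR] by metis
  interpret \<pi>: additive \<pi> by fact
  have idem: "\<pi> (\<pi> x) = \<pi> x" for x using \<pi>(2,3) by blast
  \<comment> \<open>The idempotent is 1 - \<pi>, which fixes R and kills the divisible part.\<close>
  have sep: "s = 0" if "x \<in> R" "s \<in> ?D" "\<And>i. zmul i x = 0 \<Longrightarrow> zmul i s = 0" for x s
    by (rule idempotent_separates[OF CE additive_id_diff[OF \<pi>(1)], of x s])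
      (use that \<pi>(3,4) idem in \<open>auto simp: \<pi>.diff\<close>)
  obtain d0 where d0: "d0 \<in> ?D" "d0 \<noteq> 0" using D0 subgrp_0[OF D] by blast
  have tors: "\<exists>N>0. zmul (int N) x = 0" if x: "x \<in> R" for x
  proof (rule ccontr)
    assume *: "\<not> ?thesis"
    have "i = 0" if "zmul i x = 0" for i
    proof (rule ccontr)
      assume "i \<noteq> 0"
      then have "nat \<bar>i\<bar> > 0" "zmul (int (nat \<bar>i\<bar>)) x = 0" using that by (auto simp: abs_if)
      then show False using * by blast
    qed
    then have "d0 = 0" using sep[OF x d0(1)] by fastforce
    then show False using d0 by simp
  qed
  define P1 where "P1 = {p. prime p \<and> prim p R \<noteq> {0}}"
  have "\<forall>p\<in>P1. \<exists>y k. k > 0 \<and> (\<forall>i. zmul i y = 0 \<longleftrightarrow> int p ^ k dvd i) \<and> prim p R = range (\<lambda>i. zmul i y)"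
  proof
    fix p assume "p \<in> P1"
    then have p: "prime p" "prim p R \<noteq> {0}" by (auto simp: P1_def)
    obtain s where s: "s \<in> R" "s \<noteq> 0" "zmul (int p) s = 0" using prim_ne_zero_ex[OF R p(2)] .
    show "\<exists>y k. k > 0 \<and> (\<forall>i. zmul i y = 0 \<longleftrightarrow> int p ^ k dvd i) \<and> prim p R = range (\<lambda>i. zmul i y)"
      using reduced_primary_part_cyclic[OF CE DR p(1) s] by metis
  qed
  then obtain y k where yk: "\<And>p. p \<in> P1 \<Longrightarrow> k p > 0" "\<And>p i. p \<in> P1 \<Longrightarrow> zmul i (y p) = 0 \<longleftrightarrow> int p ^ k p dvd i"
      "\<And>p. p \<in> P1 \<Longrightarrow> prim p R = range (\<lambda>i. zmul i (y p))"
    by metis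
  have isoR: "iso_onto R (cyc_sum P1 k) (cyc_sum_add k)"
    by (rule cyc_sum_iso[OF R tors _ _ yk(2,3)]) (auto simp: P1_def)
  have isoD: "iso_onto ?D (UNIV :: rat set) (+) \<or> (\<exists>P2. (\<forall>p\<in>P2. prime p) \<and> P1 \<inter> P2 = {} \<and>
           iso_onto ?D (prufer_sum P2) prufer_sum_add)"
  \<comment> \<open>An element of infinite order gives a copy of Q that already exhausts the
    divisible part; otherwise the divisible part is torsion and is settled one prime at a
    time.\<close>
  proof (cases "\<exists>d\<in>?D. \<forall>N>0. zmul (int N) d \<noteq> 0")
    case True
    then obtain d where d: "d \<in> ?D" "\<And>N. N > 0 \<Longrightarrow> zmul (int N) d \<noteq> 0" by blast
    have "i = 0" if "zmul i d = 0" for i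
    proof (rule ccontr)
      assume "i \<noteq> 0"
      then have "nat \<bar>i\<bar> > 0" "zmul (int (nat \<bar>i\<bar>)) d = 0" using that by (auto simp: abs_if)
      then show False using d(2) by blast
    qed
    then show ?thesis using rational_component[OF CE d(1)] by blast
  next
    case False
    then have torsD: "\<exists>N>0. zmul (int N) x = 0" if "x \<in> ?D" for x using that by blast
    define P2 where "P2 = {p. prime p \<and> prim p ?D \<noteq> {0}}"
    have disj: "P1 \<inter> P2 = {}"
    proof (rule ccontr)
      assume "P1 \<inter> P2 \<noteq> {}"
      then obtain p where p: "prime p" "prim p R \<noteq> {0}" "prim p ?D \<noteq> {0}" by (auto simp: P1_def P2_def)
      obtain s where s: "s \<in> R" "s \<noteq> 0" "zmul (int p) s = 0" using prim_ne_zero_ex[OF R p(2)] .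
      obtain d where d: "d \<in> ?D" "d \<noteq> 0" "zmul (int p) d = 0" using prim_ne_zero_ex[OF D p(3)] .
      \<comment> \<open>With a common prime p, an element s of order p in R could be sent to the
        element d of order p in the divisible part.\<close>
      have "d = 0"
        by (rule sep[OF s(1) d(1)])
          (simp add: zmul_order_prime_iff[OF p(1) s(2,3)] zmul_order_prime_iff[OF p(1) d(2,3)])
      then show False using d(2) by simp
    qed
    have "\<forall>p\<in>P2. \<exists>\<phi> :: rat \<Rightarrow> 'a. additive \<phi> \<and> (\<forall>i. \<phi> (of_int i) = 0) \<and>
        bij_betw \<phi> {q \<in> prime_power_fracs p. 0 \<le> q \<and> q < 1} (prim p ?D)"
    proof
      fix p assume "p \<in> P2"
      then have p: "prime p" "prim p ?D \<noteq> {0}" by (auto simp: P2_def)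
      obtain d where d: "d \<in> ?D" "d \<noteq> 0" "zmul (int p) d = 0" using prim_ne_zero_ex[OF D p(2)] .
      show "\<exists>\<phi> :: rat \<Rightarrow> 'a. additive \<phi> \<and> (\<forall>i. \<phi> (of_int i) = 0) \<and>
          bij_betw \<phi> {q \<in> prime_power_fracs p. 0 \<le> q \<and> q < 1} (prim p ?D)"
        using prufer_component[OF CE p(1) d] by metis
    qed
    then obtain \<phi> :: "nat \<Rightarrow> rat \<Rightarrow> 'a" where \<phi>: "\<And>p. p \<in> P2 \<Longrightarrow> additive (\<phi> p)"
        "\<And>p i. p \<in> P2 \<Longrightarrow> \<phi> p (of_int i) = 0"
        "\<And>p. p \<in> P2 \<Longrightarrow> bij_betw (\<phi> p) {q \<in> prime_power_fracs p. 0 \<le> q \<and> q < 1} (prim p ?D)"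
      by metis
    have "iso_onto ?D (prufer_sum P2) prufer_sum_add"
      by (rule prufer_sum_iso[OF D torsD _ _ \<phi>]) (auto simp: P2_def)
    moreover have "\<forall>p\<in>P2. prime p" by (auto simp: P2_def)
    ultimately show ?thesis using disj by blast
  qed
  have "\<forall>p\<in>P1. prime p \<and> k p > 0" using yk(1) by (auto simp: P1_def)
  with isoR isoD show ?thesis by blast
qed

section \<open>Commutativity of the endomorphism ring\<close>

text \<open>The witness z acts as a generator: an endomorphism of T cannot enlarge annihilators,
  so it maps z to an integer multiple of z.\<close>

definition small_primary :: "nat \<Rightarrow> 'a::ab_group_add set \<Rightarrow> bool" where
  "small_primary p T \<longleftrightarrow> (\<forall>t\<in>prim p T. \<exists>z\<in>T. t \<in> range (\<lambda>i. zmul i z) \<and>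
     (\<forall>w\<in>T. (\<forall>i. zmul i z = 0 \<longrightarrow> zmul i w = 0) \<longrightarrow> w \<in> range (\<lambda>i. zmul i z)))"

lemma small_primary_zero:
  assumes "prim p T = {0}" "subgrp T"
  shows "small_primary p T"
  unfolding small_primary_def
proof
  fix t assume "t \<in> prim p T"
  then have t: "t = 0" using assms(1) by simp
  have "w = 0" if "\<forall>i. zmul i (0 :: 'a) = 0 \<longrightarrow> zmul i w = 0" for w :: 'a
    using that[rule_format, of 1] by simp
  then show "\<exists>z\<in>T. t \<in> range (\<lambda>i. zmul i z) \<and>
      (\<forall>w\<in>T. (\<forall>i. zmul i z = 0 \<longrightarrow> zmul i w = 0) \<longrightarrow> w \<in> range (\<lambda>i. zmul i z))"
    using t subgrp_0[OF assms(2)] by (intro bexI[of _ 0]) auto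
qed

text \<open>On each witness z both maps are multiplication by integers, so they commute on all
  multiples of z. The elements on which they commute are closed under addition, and the primary
  parts suffice.\<close>

lemma small_primary_commute:
  assumes T: "subgrp T" "\<And>x. x \<in> T \<Longrightarrow> \<exists>N>0. zmul (int N) x = 0"
    and small: "\<And>p. prime p \<Longrightarrow> small_primary p T"
    and f: "additive f" "f ` T \<subseteq> T" and g: "additive g" "g ` T \<subseteq> T" and x: "x \<in> T"
  shows "f (g x) = g (f x)"
proof -
  interpret f: additive f by fact
  interpret g: additive g by fact
  let ?E = "{x. f (g x) = g (f x)}"
  have "prim p T \<subseteq> ?E" if p: "prime p" for p
  proof
    fix t assume "t \<in> prim p T"
    then obtain z where z: "z \<in> T" "t \<in> range (\<lambda>i. zmul i z)"
      "\<And>w. w \<in> T \<Longrightarrow> (\<And>i. zmul i z = 0 \<Longrightarrow> zmul i w = 0) \<Longrightarrow> w \<in> range (\<lambda>i. zmul i z)"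
      using small[OF p] unfolding small_primary_def by metis
    have mul: "h z \<in> range (\<lambda>i. zmul i z)" if "additive h" "h ` T \<subseteq> T" for h
    proof (rule z(3))
      show "h z \<in> T" using that z(1) by blast
      show "zmul i (h z) = 0" if "zmul i z = 0" for i
        using additive_zmul[OF \<open>additive h\<close>, of i z] additive.zero[OF \<open>additive h\<close>] that by simp
    qed
    obtain a b c where "f z = zmul a z" "g z = zmul b z" "t = zmul c z"
      using mul[OF f] mul[OF g] z(2) by blast
    then show "t \<in> ?E"
      by (simp add: additive_zmul[OF f(1)] additive_zmul[OF g(1)] mult_ac)
  qed
  moreover obtain N where "N > 0" "zmul (int N) x = 0" using T(2)[OF x] by blast
  ultimately have "x \<in> ?E"
    using mem_by_primary_parts[OF T(1), of ?E x N] x by (simp add: f.zero g.zero f.add g.add)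
  then show ?thesis by simp
qed

section \<open>Torsion and primary parts read off the concrete direct sums\<close>

lemma cyc_sum_iso_small_primary:
  fixes R :: "'a::ab_group_add set"
  assumes R: "subgrp R" and P: "\<And>p. p \<in> P \<Longrightarrow> prime p \<and> k p > 0"
    and iso: "iso_onto R (cyc_sum P k) (cyc_sum_add k)"
  shows "x \<in> R \<Longrightarrow> \<exists>N>0. zmul (int N) x = 0"
    and "prime p \<Longrightarrow> p \<notin> P \<Longrightarrow> prim p R = {0}"
    and "prime p \<Longrightarrow> small_primary p R"
proof -
  obtain h where h: "bij_betw h R (cyc_sum P k)"
    and add: "\<And>x y. x \<in> R \<Longrightarrow> y \<in> R \<Longrightarrow> h (x + y) = cyc_sum_add k (h x) (h y)"
    using iso unfolding iso_onto_def by blast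
  have hin: "h x \<in> cyc_sum P k" if "x \<in> R" for x using bij_betwE[OF h] that by blast
  have fin: "finite {p. h x p \<noteq> 0}" and out: "p \<notin> P \<Longrightarrow> h x p = 0"
    and bound: "p \<in> P \<Longrightarrow> 0 \<le> h x p" "p \<in> P \<Longrightarrow> h x p < int p ^ k p" if "x \<in> R" for x p
    using hin[OF that] by (auto simp: cyc_sum_def)
  have inj: "x = y" if "h x = h y" "x \<in> R" "y \<in> R" for x y
    using bij_betw_imp_inj_on[OF h] that by (rule inj_onD)
  have red: "h x p mod int p ^ k p = h x p" if "x \<in> R" for x p
    using out[OF that, of p] bound[OF that, of p] by (cases "p \<in> P") auto
  have h0: "h 0 p = 0" for p
  proof -
    \<comment> \<open>As h is only known to be a bijection carrying + to the model operation, h 0 =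
      0 has to be derived: h 0 p is congruent to its own double and is a reduced residue.\<close>
    have "h 0 p = (h 0 p + h 0 p) mod int p ^ k p"
      using add[of 0 0] subgrp_0[OF R] by (simp add: cyc_sum_add_def fun_eq_iff)
    also have "h 0 p = h 0 p mod int p ^ k p" using red[OF subgrp_0[OF R]] by simp
    finally have "int p ^ k p dvd h 0 p"
      by (metis add_diff_cancel_right' mod_add_self2 mod_eq_dvd_iff mod_mod_trivial red[OF subgrp_0[OF R]])
    then show ?thesis using red[OF subgrp_0[OF R], of p] by (simp add: mod_eq_0_iff_dvd[symmetric])
  qed
  have hn: "h (nsmul n x) p = int n * h x p mod int p ^ k p" if x: "x \<in> R" for n x p
  proof (induction n)
    case 0
    then show ?case by (simp add: h0)
  next
    case (Suc n)
    have "nsmul n x \<in> R" using subgrp_zmul[OF R x, of "int n"] by (simp add: zmul_int)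
    then have "h (nsmul (Suc n) x) p = (h x p + h (nsmul n x) p) mod int p ^ k p"
      using add[OF x] by (simp add: cyc_sum_add_def)
    also have "\<dots> = (h x p + int n * h x p) mod int p ^ k p" by (simp add: Suc.IH mod_simps)
    finally show ?case by (simp add: algebra_simps)
  qed
  have kill: "zmul (int n) x = 0 \<longleftrightarrow> (\<forall>p. int p ^ k p dvd int n * h x p)" if x: "x \<in> R" for n x
  proof -
    have "zmul (int n) x \<in> R" by (rule subgrp_zmul[OF R x])
    then have "zmul (int n) x = 0 \<longleftrightarrow> h (zmul (int n) x) = h 0" using inj subgrp_0[OF R] by metis
    also have "\<dots> \<longleftrightarrow> (\<forall>p. int n * h x p mod int p ^ k p = 0)"
      by (simp add: fun_eq_iff h0 zmul_int hn[OF x])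
    finally show ?thesis by (simp add: mod_eq_0_iff_dvd)
  qed
  have prim_off: "h t q = 0" if t: "t \<in> prim p R" and p: "prime p" and "q \<noteq> p" for t p q
  proof (cases "q \<in> P")
    case True
    obtain n where n: "t \<in> R" "zmul (int (p ^ n)) t = 0" using t by (auto simp: prim_def)
    then have "int q ^ k q dvd int (p ^ n) * h t q" using kill by blast
    moreover have "coprime (int q ^ k q) (int (p ^ n))"
      using P[OF True] p \<open>q \<noteq> p\<close> by (simp add: primes_coprime)
    ultimately have "int q ^ k q dvd h t q" by (metis coprime_dvd_mult_right_iff)
    then show ?thesis using red[OF n(1), of q] by (simp add: mod_eq_0_iff_dvd[symmetric])
  next
    case False
    then show ?thesis using out t by (auto simp: prim_def)
  qed
  show "\<exists>N>0. zmul (int N) x = 0" if x: "x \<in> R" for x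
  proof -
    define N where "N = (\<Prod>p\<in>{p. h x p \<noteq> 0}. p ^ k p)"
    have "int p ^ k p dvd int N * h x p" for p
    proof (cases "h x p = 0")
      case False
      then have "p ^ k p dvd N" unfolding N_def using fin[OF x] by (intro dvd_prodI) auto
      then have "int (p ^ k p) dvd int N" by (simp only: int_dvd_int_iff)
      then show ?thesis by simp
    qed simp
    then have "zmul (int N) x = 0" using kill[OF x] by blast
    moreover have "N > 0" unfolding N_def
    proof (rule prod_pos)
      fix p assume "p \<in> {p. h x p \<noteq> 0}"
      then have "p \<in> P" using out[OF x] by blast
      then show "0 < p ^ k p" using P prime_gt_0_nat by simp
    qed
    ultimately show ?thesis by blast
  qed
  show notin: "prim p R = {0}" if p: "prime p" "p \<notin> P" for p
  proof -
    have "t = 0" if t: "t \<in> prim p R" for t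
    proof -
      have "t \<in> R" using t by (simp add: prim_def)
      then have "h t q = h 0 q" for q using prim_off[OF t p(1)] out p(2) h0 by (cases "q = p") auto
      then show ?thesis using inj \<open>t \<in> R\<close> subgrp_0[OF R] by (metis ext)
    qed
    then show ?thesis using subgrp_0[OF subgrp_prim[OF R]] by blast
  qed
  show "small_primary p R" if p: "prime p" for p
  proof (cases "p \<in> P")
    case False
    then show ?thesis using notin p R by (intro small_primary_zero)
  next
    case True
    \<comment> \<open>The unit vector at p generates the whole primary part, so one z serves for all
      t. It is a legitimate element because \<open>k p > 0\<close> makes 1 a residue below
      p^k.\<close>
    let ?\<delta> = "(\<lambda>_. 0)(p := 1 :: int)"
    have "1 < int p ^ k p" using P[OF True] prime_gt_1_nat by (simp add: one_less_power)
    moreover have "finite {q. ?\<delta> q \<noteq> 0}" by (rule finite_subset[of _ "{p}"]) auto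
    ultimately have "?\<delta> \<in> cyc_sum P k" using True P prime_gt_0_nat by (auto simp: cyc_sum_def)
    then obtain z where z: "z \<in> R" "h z = ?\<delta>" using bij_betw_imp_surj_on[OF h] by (metis imageE)
    have gen: "t \<in> range (\<lambda>i. zmul i z)" if t: "t \<in> prim p R" for t
    proof -
      have tR: "t \<in> R" using t by (simp add: prim_def)
      have "h (nsmul (nat (h t p)) z) q = h t q" for q
        using prim_off[OF t p, of q] bound(1)[OF tR True] red[OF tR, of p] hn[OF z(1)] z(2)
        by (cases "q = p") auto
      moreover have "nsmul (nat (h t p)) z \<in> R"
        using subgrp_zmul[OF R z(1), of "int (nat (h t p))"] by (simp only: zmul_int)
      ultimately have "nsmul (nat (h t p)) z = t" using inj tR by blast
      then show ?thesis by (metis rangeI zmul_int)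
    qed
    have zk: "zmul (int p ^ k p) z = 0"
    proof -
      have "int q ^ k q dvd int (p ^ k p) * h z q" for q using z(2) by (cases "q = p") auto
      then have "zmul (int (p ^ k p)) z = 0" using kill[OF z(1)] by blast
      then show ?thesis by simp
    qed
    show ?thesis unfolding small_primary_def
    proof (intro ballI bexI conjI impI)
      show "z \<in> R" by fact
      show "t \<in> range (\<lambda>i. zmul i z)" if "t \<in> prim p R" for t by (rule gen[OF that])
      fix w assume w: "w \<in> R" "\<forall>i. zmul i z = 0 \<longrightarrow> zmul i w = 0"
      then have "w \<in> prim p R" using zk unfolding prim_def by blast
      then show "w \<in> range (\<lambda>i. zmul i z)" by (rule gen)
    qed
  qed
qed

lemma prufer_sum_iso_small_primary:
  fixes D :: "'a::ab_group_add set"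
  assumes D: "subgrp D" and P: "\<And>p. p \<in> P \<Longrightarrow> prime p"
    and iso: "iso_onto D (prufer_sum P) prufer_sum_add"
  shows "x \<in> D \<Longrightarrow> \<exists>N>0. zmul (int N) x = 0"
    and "prime p \<Longrightarrow> p \<notin> P \<Longrightarrow> prim p D = {0}"
    and "prime p \<Longrightarrow> small_primary p D"
proof -
  obtain h where h: "bij_betw h D (prufer_sum P)"
    and add: "\<And>x y. x \<in> D \<Longrightarrow> y \<in> D \<Longrightarrow> h (x + y) = prufer_sum_add (h x) (h y)"
    using iso unfolding iso_onto_def by blast
  have hin: "h x \<in> prufer_sum P" if "x \<in> D" for x using bij_betwE[OF h] that by blast
  have fin: "finite {p. h x p \<noteq> 0}" and out: "p \<notin> P \<Longrightarrow> h x p = 0"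
    and bound: "p \<in> P \<Longrightarrow> 0 \<le> h x p" "p \<in> P \<Longrightarrow> h x p < 1"
    and den: "p \<in> P \<Longrightarrow> \<exists>n. h x p * of_nat (p ^ n) \<in> \<int>" if "x \<in> D" for x p
    using hin[OF that] by (auto simp: prufer_sum_def)
  have inj: "x = y" if "h x = h y" "x \<in> D" "y \<in> D" for x y
    using bij_betw_imp_inj_on[OF h] that by (rule inj_onD)
  have red: "frac (h x p) = h x p" if "x \<in> D" for x p
    using out[OF that, of p] bound[OF that, of p] by (cases "p \<in> P") (auto simp: frac_eq)
  have h0: "h 0 p = 0" for p
  proof -
    have "h 0 p = frac (h 0 p + h 0 p)"
      using add[of 0 0] subgrp_0[OF D] by (simp add: prufer_sum_add_def fun_eq_iff)
    \<comment> \<open>The same doubling argument modulo 1: h 0 p is an integer in [0,1).\<close>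
    then have "h 0 p = h 0 p + h 0 p - of_int \<lfloor>h 0 p + h 0 p\<rfloor>" by (simp only: frac_def)
    then have "h 0 p = of_int \<lfloor>h 0 p + h 0 p\<rfloor>" by linarith
    then have "h 0 p \<in> \<int>" by (metis Ints_of_int)
    then show ?thesis using red[OF subgrp_0[OF D], of p] by (metis frac_eq_0_iff)
  qed
  have hn: "h (nsmul n x) p = frac (of_nat n * h x p)" if x: "x \<in> D" for n x p
  proof (induction n)
    case 0
    then show ?case by (simp add: h0)
  next
    case (Suc n)
    have "nsmul n x \<in> D" using subgrp_zmul[OF D x, of "int n"] by (simp add: zmul_int)
    then have "h (nsmul (Suc n) x) p = frac (h x p + h (nsmul n x) p)"
      using add[OF x] by (simp add: prufer_sum_add_def)
    also have "\<dots> = frac (h x p + of_nat n * h x p)" by (simp add: Suc.IH)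
    finally show ?case by (simp add: algebra_simps)
  qed
  have kill: "zmul (int n) x = 0 \<longleftrightarrow> (\<forall>p. of_nat n * h x p \<in> \<int>)" if x: "x \<in> D" for n x
  proof -
    have "zmul (int n) x \<in> D" by (rule subgrp_zmul[OF D x])
    then have "zmul (int n) x = 0 \<longleftrightarrow> h (zmul (int n) x) = h 0" using inj subgrp_0[OF D] by metis
    then show ?thesis by (simp add: fun_eq_iff h0 zmul_int hn[OF x])
  qed
  have prim_off: "h t q = 0" if t: "t \<in> prim p D" and p: "prime p" and "q \<noteq> p" for t p q
  proof (cases "q \<in> P")
    case True
    obtain n where n: "t \<in> D" "zmul (int (p ^ n)) t = 0" using t by (auto simp: prim_def)
    obtain m where m: "h t q * of_nat (q ^ m) \<in> \<int>" using den[OF n(1) True] by blast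
    have "coprime (p ^ n) (q ^ m)" using P[OF True] p \<open>q \<noteq> p\<close> by (simp add: primes_coprime)
    then have "coprime (int (p ^ n)) (int (q ^ m))" by (simp only: coprime_int_iff)
    then obtain u v where uv: "u * int (p ^ n) + v * int (q ^ m) = 1"
      by (metis bezout_int coprime_iff_gcd_eq_1)
    \<comment> \<open>Both p^n and q^m turn the coordinate at q into an integer, hence so does their
      Bezout combination 1.\<close>
    have "of_int u * (of_nat (p ^ n) * h t q) + of_int v * (h t q * of_nat (q ^ m)) \<in> \<int>"
    proof -
      have "of_nat (p ^ n) * h t q \<in> \<int>" using n kill by blast
      then show ?thesis using m by (meson Ints_add Ints_mult Ints_of_int)
    qed
    moreover have "of_int u * (of_nat (p ^ n) * h t q) + of_int v * (h t q * of_nat (q ^ m))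
        = of_int (u * int (p ^ n) + v * int (q ^ m)) * h t q" by (simp add: algebra_simps)
    ultimately have "h t q \<in> \<int>" by (simp only: uv of_int_1 mult_1_left)
    then show ?thesis using red[OF n(1), of q] by (metis frac_eq_0_iff)
  next
    case False
    then show ?thesis using out t by (auto simp: prim_def)
  qed
  show "\<exists>N>0. zmul (int N) x = 0" if x: "x \<in> D" for x
  proof -
    have "\<forall>p\<in>P. \<exists>n. h x p * of_nat (p ^ n) \<in> \<int>" using den[OF x] by blast
    then obtain n where n: "\<And>p. p \<in> P \<Longrightarrow> h x p * of_nat (p ^ n p) \<in> \<int>" by metis
    define N where "N = (\<Prod>p\<in>{p. h x p \<noteq> 0}. p ^ n p)"
    have "of_nat N * h x p \<in> \<int>" for p
    proof (cases "h x p = 0")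
      case False
      then have "p ^ n p dvd N" unfolding N_def using fin[OF x] by (intro dvd_prodI) auto
      then obtain c where "N = p ^ n p * c" by blast
      then have "of_nat N * h x p = of_nat c * (h x p * of_nat (p ^ n p))" by simp
      moreover have "p \<in> P" using False out[OF x] by blast
      ultimately show ?thesis using n by (metis Ints_mult Ints_of_nat)
    qed simp
    then have "zmul (int N) x = 0" using kill[OF x] by blast
    moreover have "N > 0" unfolding N_def
    proof (rule prod_pos)
      fix p assume "p \<in> {p. h x p \<noteq> 0}"
      then have "p \<in> P" using out[OF x] by blast
      then show "0 < p ^ n p" using P prime_gt_0_nat by simp
    qed
    ultimately show ?thesis by blast
  qed
  show notin: "prim p D = {0}" if p: "prime p" "p \<notin> P" for p
  proof -
    have "t = 0" if t: "t \<in> prim p D" for t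
    proof -
      have "t \<in> D" using t by (simp add: prim_def)
      then have "h t q = h 0 q" for q using prim_off[OF t p(1)] out p(2) h0 by (cases "q = p") auto
      then show ?thesis using inj \<open>t \<in> D\<close> subgrp_0[OF D] by (metis ext)
    qed
    then show ?thesis using subgrp_0[OF subgrp_prim[OF D]] by blast
  qed
  show "small_primary p D" if p: "prime p" for p
  proof (cases "p \<in> P")
    case False
    then show ?thesis using notin p D by (intro small_primary_zero)
  next
    case True
    show ?thesis unfolding small_primary_def
    proof
      fix t assume "t \<in> prim p D"
      then obtain n where t: "t \<in> D" "zmul (int p ^ n) t = 0" by (auto simp: prim_def)
      \<comment> \<open>A quasi-cyclic group has no single generator, so z depends on t: it is
        1/p^(n+1), generating all elements killed by p^(n+1). The exponent n + 1 in place of n keeps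
        1/m below 1 even when n = 0.\<close>
      have tn: "zmul (int (p ^ Suc n)) t = 0"
      proof -
        have "zmul (int (p ^ Suc n)) t = zmul (int p) (zmul (int p ^ n) t)" by simp
        then show ?thesis using t(2) by (simp del: zm.scale_scale)
      qed
      define m where "m = p ^ Suc n"
      have m: "m > 1" unfolding m_def using one_less_power[OF prime_gt_1_nat[OF p]] by blast
      let ?\<delta> = "(\<lambda>_. 0)(p := 1 / of_nat m :: rat)"
      have "finite {q. ?\<delta> q \<noteq> 0}" by (rule finite_subset[of _ "{p}"]) auto
      moreover have "?\<delta> p * of_nat (p ^ Suc n) \<in> \<int>" using m unfolding m_def[symmetric] by simp
      then have "\<exists>n. ?\<delta> q * of_nat (q ^ n) \<in> \<int>" for q by (cases "q = p") (blast, simp)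
      ultimately have "?\<delta> \<in> prufer_sum P" using True m by (auto simp: prufer_sum_def)
      then obtain z where z: "z \<in> D" "h z = ?\<delta>" using bij_betw_imp_surj_on[OF h] by (metis imageE)
      have gen: "w \<in> range (\<lambda>i. zmul i z)" if w: "w \<in> D" "zmul (int m) w = 0" for w
      proof -
        have "zmul (int p ^ Suc n) w = 0" using w(2) by (simp add: m_def)
        then have wp: "w \<in> prim p D" using w(1) unfolding prim_def by blast
        have "of_nat m * h w p \<in> \<int>" using kill[OF w(1)] w(2) by blast
        then obtain i where i: "of_nat m * h w p = of_int i" by (elim Ints_cases)
        moreover have "0 \<le> of_nat m * h w p" using bound(1)[OF w(1) True] by simp
        ultimately have "i \<ge> 0" by simp
        have wi: "h w p = of_int i / of_nat m" using i m by (simp add: field_simps)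
        have "h (nsmul (nat i) z) q = h w q" for q
          using prim_off[OF wp p, of q] red[OF w(1), of p] hn[OF z(1), of "nat i" q] z(2) wi \<open>i \<ge> 0\<close>
          by (cases "q = p") auto
        moreover have "nsmul (nat i) z \<in> D"
          using subgrp_zmul[OF D z(1), of "int (nat i)"] by (simp only: zmul_int)
        ultimately have "nsmul (nat i) z = w" using inj w(1) by blast
        then show ?thesis by (metis rangeI zmul_int)
      qed
      have zm: "zmul (int m) z = 0"
      proof -
        have "of_nat m * h z q \<in> \<int>" for q using z(2) m by (cases "q = p") auto
        then show ?thesis using kill[OF z(1)] by blast
      qed
      show "\<exists>z\<in>D. t \<in> range (\<lambda>i. zmul i z) \<and>
        (\<forall>w\<in>D. (\<forall>i. zmul i z = 0 \<longrightarrow> zmul i w = 0) \<longrightarrow> w \<in> range (\<lambda>i. zmul i z))"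
      proof (intro bexI[OF _ z(1)] conjI ballI impI)
        show "t \<in> range (\<lambda>i. zmul i z)" using gen[OF t(1)] tn by (simp only: m_def)
        show "w \<in> range (\<lambda>i. zmul i z)" if "w \<in> D" "\<forall>i. zmul i z = 0 \<longrightarrow> zmul i w = 0" for w
          using gen[OF that(1)] zm that(2) by blast
      qed
    qed
  qed
qed

text \<open>After transport to Q every endomorphism is multiplication by its value at 1, because Q
  is torsion-free and divisible; rational scalars commute.\<close>

lemma rat_iso_commute:
  fixes D :: "'a::ab_group_add set"
  assumes D: "subgrp D" and iso: "iso_onto D (UNIV :: rat set) (+)"
  shows "prime p \<Longrightarrow> prim p D = {0}"
    and "\<lbrakk>additive f; f ` D \<subseteq> D; additive g; g ` D \<subseteq> D; x \<in> D\<rbrakk> \<Longrightarrow> f (g x) = g (f x)"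
proof -
  obtain h :: "'a \<Rightarrow> rat" where h: "bij_betw h D UNIV"
    and add: "\<And>x y. x \<in> D \<Longrightarrow> y \<in> D \<Longrightarrow> h (x + y) = h x + h y"
    using iso unfolding iso_onto_def by blast
  define \<theta> where "\<theta> = inv_into D h"
  have \<theta>D: "\<theta> q \<in> D" and h\<theta>: "h (\<theta> q) = q" for q
    using bij_betw_imp_surj_on[OF h] by (auto simp: \<theta>_def inv_into_into f_inv_into_f)
  have \<theta>h: "\<theta> (h x) = x" if "x \<in> D" for x
    using bij_betw_imp_inj_on[OF h] that by (simp add: \<theta>_def)
  have \<theta>: "additive \<theta>"
  proof
    fix q r
    show "\<theta> (q + r) = \<theta> q + \<theta> r"
      using \<theta>h[OF subgrp_add[OF D \<theta>D \<theta>D], of q r] add[OF \<theta>D \<theta>D] h\<theta> by simp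
  qed
  have \<theta>mul: "zmul i (\<theta> q) = \<theta> (of_int i * q)" for i q
    using additive_zmul[OF \<theta>, of i q] by (simp add: zmul_rat)
  have \<theta>inj: "q = r" if "\<theta> q = \<theta> r" for q r using that h\<theta> by metis
  show "prim p D = {0}" if p: "prime p" for p
  proof -
    have "t = 0" if "t \<in> prim p D" for t
    proof -
      obtain n where t: "t \<in> D" "zmul (int p ^ n) t = 0" using \<open>t \<in> prim p D\<close> by (auto simp: prim_def)
      then have "\<theta> (of_int (int p ^ n) * h t) = \<theta> 0"
        using \<theta>mul[of "int p ^ n" "h t"] \<theta>h additive.zero[OF \<theta>] by simp
      then have "of_int (int p ^ n) * h t = 0" by (rule \<theta>inj)
      then have "h t = 0" using prime_gt_0_nat[OF p] by simp
      then show "t = 0" using \<theta>h[OF t(1)] additive.zero[OF \<theta>] by simp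
    qed
    then show ?thesis using subgrp_0[OF subgrp_prim[OF D]] by blast
  qed
  have scalar: "f (\<theta> q) = \<theta> (q * h (f (\<theta> 1)))" if f: "additive f" "f ` D \<subseteq> D" for f q
  proof -
    obtain a b where ab: "b > 0" "q = of_int a / of_int b"
      by (metis quotient_of_div quotient_of_denom_pos surj_pair)
    have fD: "f (\<theta> r) \<in> D" for r using f(2) \<theta>D by blast
    \<comment> \<open>Clearing the denominator b of q moves the computation to multiples of the
      image of 1; since \<theta> is injective on Q, b can be cancelled afterwards.\<close>
    have "zmul b (\<theta> q) = zmul a (\<theta> 1)" using ab by (simp add: \<theta>mul)
    then have "zmul b (f (\<theta> q)) = zmul a (f (\<theta> 1))"
      by (metis additive_zmul[OF f(1)])
    then have "zmul b (\<theta> (h (f (\<theta> q)))) = zmul a (\<theta> (h (f (\<theta> 1))))" by (simp add: \<theta>h fD)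
    then have "of_int b * h (f (\<theta> q)) = of_int a * h (f (\<theta> 1))" unfolding \<theta>mul by (rule \<theta>inj)
    moreover have "of_int a = of_int b * q" using ab by simp
    ultimately have "of_int b * h (f (\<theta> q)) = of_int b * (q * h (f (\<theta> 1)))" by simp
    then have "h (f (\<theta> q)) = q * h (f (\<theta> 1))" using ab(1) by simp
    then show ?thesis using \<theta>h[OF fD] by metis
  qed
  show "f (g x) = g (f x)" if fg: "additive f" "f ` D \<subseteq> D" "additive g" "g ` D \<subseteq> D" and x: "x \<in> D" for f g x
  proof -
    have "f (g (\<theta> q)) = \<theta> (q * h (g (\<theta> 1)) * h (f (\<theta> 1)))" for q
      by (subst scalar[OF fg(3,4)], subst scalar[OF fg(1,2)]) simp
    moreover have "g (f (\<theta> q)) = \<theta> (q * h (g (\<theta> 1)) * h (f (\<theta> 1)))" for q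
      by (subst scalar[OF fg(1,2)], subst scalar[OF fg(3,4)]) (simp add: mult_ac)
    ultimately have "f (g (\<theta> (h x))) = g (f (\<theta> (h x)))" by simp
    then show ?thesis by (simp only: \<theta>h[OF x])
  qed
qed

section \<open>From the stated structure back to central essentiality\<close>

lemma End_centrally_essential_if_commutative:
  assumes "\<And>f g x. additive f \<Longrightarrow> additive g \<Longrightarrow> f (g x) = g (f x :: 'a::ab_group_add)"
    and "(x :: 'a) \<noteq> 0"
  shows "End_centrally_essential TYPE('a)"
proof -
  have center: "End_center = (End_ring :: ('a \<Rightarrow> 'a) set)"
    using assms(1) by (auto simp: End_center_def End_ring_iff fun_eq_iff)
  have "id \<in> (End_ring :: ('a \<Rightarrow> 'a) set)" "id \<noteq> (\<lambda>_ :: 'a. 0 :: 'a)"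
    using assms(2) by (auto simp: End_ring_def fun_eq_iff)
  \<comment> \<open>For a non-zero a the central witnesses are x = \<open>id\<close> and y = a
    itself.\<close>
  then show ?thesis unfolding End_centrally_essential_def center by (metis comp_id)
qed

text \<open>Both summands are invariant under every endomorphism, so commutativity can be checked on
  each of them separately and then carried to sums d + r.\<close>

lemma centrally_essential_if_structure:
  fixes R :: "'a::ab_group_add set"
  assumes DR: "is_direct_complement (div_part :: 'a set) R" and D0: "(div_part :: 'a set) \<noteq> {0}"
    and P1: "\<And>p. p \<in> P1 \<Longrightarrow> prime p \<and> k p > 0" and isoR: "iso_onto R (cyc_sum P1 k) (cyc_sum_add k)"
    and isoD: "iso_onto (div_part :: 'a set) (UNIV :: rat set) (+) \<or>
      (\<exists>P2. (\<forall>p\<in>P2. prime p) \<and> P1 \<inter> P2 = {} \<and> iso_onto (div_part :: 'a set) (prufer_sum P2) prufer_sum_add)"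
  shows "End_centrally_essential TYPE('a)"
proof -
  let ?D = "div_part :: 'a set"
  have R: "subgrp R" and sum: "\<And>a. \<exists>d\<in>?D. \<exists>r\<in>R. a = d + r"
    using DR by (auto simp: is_direct_complement_def)
  have D: "subgrp ?D" using divisible_div_part by (rule divisible_subgrpD)
  obtain \<pi> where \<pi>: "additive \<pi>" "range \<pi> \<subseteq> ?D" "\<And>x. x - \<pi> x \<in> R"
    using projection_ex[OF DR] by metis
  have torsR: "\<exists>N>0. zmul (int N) x = 0" if "x \<in> R" for x
    using cyc_sum_iso_small_primary(1)[OF R P1 isoR that] .
  have primR: "prim p R = {0}" if "prime p" "p \<notin> P1" for p
    using cyc_sum_iso_small_primary(2)[OF R P1 isoR that] .
  have smallR: "small_primary p R" if "prime p" for p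
    using cyc_sum_iso_small_primary(3)[OF R P1 isoR that] .
  \<comment> \<open>Here the disjointness of the two sets of primes enters; in the other alternative
    the rationals are torsion-free.\<close>
  have primD: "prim p ?D = {0}" if p: "p \<in> P1" for p
    using isoD
  proof (elim disjE exE conjE)
    assume "iso_onto ?D (UNIV :: rat set) (+)"
    then show ?thesis using rat_iso_commute(1)[OF D] P1[OF p] by blast
  next
    fix P2 assume "\<forall>p\<in>P2. prime p" "P1 \<inter> P2 = {}" "iso_onto ?D (prufer_sum P2) prufer_sum_add"
    then show ?thesis using prufer_sum_iso_small_primary(2)[OF D, of P2 p] P1[OF p] p by blast
  qed
  have fD: "f ` ?D \<subseteq> ?D" if "additive f" for f :: "'a \<Rightarrow> 'a"
    using additive_image_divisible[OF that divisible_div_part] by (rule subset_div_part)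
  have fR: "f ` R \<subseteq> R" if f: "additive f" for f :: "'a \<Rightarrow> 'a"
  proof
    interpret f: additive f by fact
    fix y assume "y \<in> f ` R"
    then obtain x where x: "x \<in> R" "y = f x" by blast
    obtain N where N: "N > 0" "zmul (int N) x = 0" using torsR[OF x(1)] by blast
    have "prim p R \<subseteq> {x. f x \<in> R}" if p: "prime p" for p
    proof (cases "p \<in> P1")
      case False
      then show ?thesis using primR[OF p] subgrp_0[OF R] by (simp add: f.zero)
    next
      case True
      show ?thesis
      proof
        fix t assume "t \<in> prim p R"
        then obtain n where n: "zmul (int p ^ n) t = 0" by (auto simp: prim_def)
        \<comment> \<open>The component of f t in the divisible part is again p-primary, and for p
          in \<open>P1\<close> the divisible part has no such element except 0.\<close>
        have "zmul (int p ^ n) (\<pi> (f t)) = 0"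
          by (simp add: additive_zmul[OF \<pi>(1), symmetric] additive_zmul[OF f, symmetric] n f.zero
              additive.zero[OF \<pi>(1)])
        then have "\<pi> (f t) \<in> prim p ?D" using \<pi>(2) unfolding prim_def by blast
        then have "\<pi> (f t) = 0" using primD[OF True] by simp
        then show "t \<in> {x. f x \<in> R}" using \<pi>(3)[of "f t"] by simp
      qed
    qed
    then have "x \<in> {x. f x \<in> R}"
      using mem_by_primary_parts[OF R, of "{x. f x \<in> R}" x N] x(1) N subgrp_0[OF R] subgrp_add[OF R]
      by (simp add: f.zero f.add)
    then show "y \<in> R" using x(2) by simp
  qed
  have commD: "f (g x) = g (f x)" if fg: "additive f" "additive g" and x: "x \<in> ?D" for f g :: "'a \<Rightarrow> 'a" and x
    using isoD
  proof (elim disjE exE conjE)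
    assume "iso_onto ?D (UNIV :: rat set) (+)"
    then show ?thesis using rat_iso_commute(2)[OF D _ fg(1) fD[OF fg(1)] fg(2) fD[OF fg(2)] x] by blast
  next
    fix P2 assume P2: "\<forall>p\<in>P2. prime p" and iso: "iso_onto ?D (prufer_sum P2) prufer_sum_add"
    have P2': "prime p" if "p \<in> P2" for p using P2 that by blast
    note struct = prufer_sum_iso_small_primary[OF D P2' iso]
    show ?thesis
      by (rule small_primary_commute[OF D struct(1,3) fg(1) fD[OF fg(1)] fg(2) fD[OF fg(2)] x])
  qed
  have commR: "f (g x) = g (f x)" if fg: "additive f" "additive g" and x: "x \<in> R" for f g :: "'a \<Rightarrow> 'a" and x
    by (rule small_primary_commute[OF R torsR smallR fg(1) fR[OF fg(1)] fg(2) fR[OF fg(2)] x])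
  obtain d0 where "d0 \<in> ?D" "d0 \<noteq> 0" using D0 subgrp_0[OF D] by blast
  show ?thesis
  proof (rule End_centrally_essential_if_commutative[OF _ \<open>d0 \<noteq> 0\<close>])
    fix f g :: "'a \<Rightarrow> 'a" and x
    assume fg: "additive f" "additive g"
    obtain d r where "d \<in> ?D" "r \<in> R" "x = d + r" using sum by blast
    then show "f (g x) = g (f x)"
      using commD[OF fg] commR[OF fg] additive.add[OF fg(1)] additive.add[OF fg(2)] by simp
  qed
qed

theorem theorem2p4:
  fixes R :: "'a::ab_group_add set"
  assumes "is_direct_complement (div_part :: 'a set) R"
    and "(div_part :: 'a set) \<noteq> {0}"
    and "R \<noteq> {0}"
  shows "End_centrally_essential TYPE('a) \<longleftrightarrow>
    (\<exists>P1 :: nat set. \<exists>k :: nat \<Rightarrow> nat.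
       (\<forall>p\<in>P1. prime p \<and> k p > 0) \<and>
       iso_onto R (cyc_sum P1 k) (cyc_sum_add k) \<and>
       (iso_onto (div_part :: 'a set) (UNIV :: rat set) (+) \<or>
        (\<exists>P2 :: nat set. (\<forall>p\<in>P2. prime p) \<and> P1 \<inter> P2 = {} \<and>
           iso_onto (div_part :: 'a set) (prufer_sum P2) prufer_sum_add)))"
  (is "_ = ?S")
proof
  assume "End_centrally_essential TYPE('a)"
  then show ?S by (rule structure_if_centrally_essential[OF _ assms(1,2)])
next
  assume ?S
  then show "End_centrally_essential TYPE('a)"
    by (elim exE conjE) (rule centrally_essential_if_structure[OF assms(1,2)], auto)
qed

end
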